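(* Let the delay differential equation $\dot u(t)=f\bigl(t,u(t),u(t-\tau_1(t,u(t))),\dots,u(t-\tau_N(t,u(t)))\bigr)$ for $t\geq t_0$, $u(t)=\varphi(t)$ for $t\leq t_0$, satisfy the standing assumptions listed in the context (with the integer $k\geq 1$ and the constants $\delta_0,L$ appearing there). For $\delta\in(0,\delta_0]$, $x\in\mathbb{R}^d$ with $|x|=\delta$, and $t^*\geq t_0+kr(\delta)$, let $E_{(k)}(\delta,x,t^* )$ be the set defined in the context. For $i=1,\dots,N$ and $(\eta_1,\dots,\eta_N)\in E_{(k)}(\delta,x,t^* )$ consider the auxiliary ODE problem $$\dot v(\theta)=f\bigl(t^*+\theta,v(\theta),\eta_1(\theta),\dots,\eta_N(\theta)\bigr),\quad \theta\in[-\tau_i(t^*,x),0],\qquad v(-\tau_i(t^*,x))=\eta_i(0),$$ with solution denoted $v(x,\eta_1,\dots,\eta_N)(\theta)$. Suppose there exists $\delta_1\in(0,\delta_0]$ such that for all $\delta\in(0,\delta_1)$, every $x$ with $|x|=\delta$, all $t^*\geq t_0+kr(\delta)$ and all $(\eta_1,\dots,\eta_N)\in E_{(k)}(\delta,x,t^* )$, the solution of the auxiliary ODE problem for some $i=I\in\{1,\dots,N\}$ satisfies $\tau_I(t^*,x)>0$ and either $$\tfrac1\delta\, v(x,\eta_1,\dots,\eta_N)(0)\cdot x<\delta,$$ or $$\tfrac1\delta\, v(x,\eta_1,\dots,\eta_N)(0)\cdot x=\delta\quad\text{and}\quad \dot v(x,\eta_1,\dots,\eta_N)(0)\cdot x\leq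 0.$$ Then the zero solution of the delay differential equation is Lyapunov stable. Moreover, if $\delta\in(0,\delta_1)$ and $|\varphi(s)|<\delta e^{-Lkr(\delta)}$ for $s\in[t_0-r(\delta),t_0]$, then the solution of the delay differential equation satisfies $|u(t)|\leq\delta$ for all $t\geq t_0$.
   Context: $\mathbb{R}^d$ carries the Euclidean inner product $\cdot$ and norm $|\cdot|$; $B(0,\delta)$ is the closed ball of radius $\delta$ about $0$. For $\delta>0$ let $r(\delta)=\sup\{\tau_i(t,u): t\geq t_0,\ |u|\leq\delta,\ i=1,\dots,N\}$. Standing assumptions. $d,N,k\geq 1$ are integers and $t_0\in\mathbb{R}$. (1) $f:[t_0,\infty)\times\mathbb{R}^{(N+1)d}\to\mathbb{R}^d$ and $\tau_i:[t_0,\infty)\times\mathbb{R}^d\to\mathbb{R}$ ($i=1,\dots,N$) are continuous. (2) $f(t,0,0,\dots,0)=0$ for all $t\geq t_0$. (3) $\tau_{\max}=\max_i\sup_{t\geq t_0}\tau_i(t,0)\in(0,\infty)$. (4) There are positive constants $L_0,\dots,L_N$ and $\delta_0$ such that $|f(t,u,v_1,\dots,v_N)-f(t,\tilde u,\tilde v_1,\dots,\tilde v_N)|\leq L_0|u-\tilde u|+L_1|v_1-\tilde v_1|+\dots+L_N|v_N-\tilde v_N|$ for all $t\geq t_0$ and all $u,v_j,\tilde u,\tilde v_j\in B(0,\delta_0)$. Let $L=L_0+L_1+\dots+L_N$. (5) The $\tau_i(t,u)$ are nonnegative and Lipschitz continuous in $u$ on $[t_0,\infty)\times B(0,\delta_0)$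 with Lipschitz constants $L_{\tau_i}$. (6) $f(t,u,v_1,\dots,v_N)$ is at least $\max\{k-2,0\}$ times differentiable in its $u$ and $v$ variables, and $\tau_i(t,u)$ is at least $\max\{k-1,0\}$ times differentiable in $u$. (7) Initial functions $\varphi$ belong to $C:=C([t_0-r(\delta_0),t_0],\mathbb{R}^d)$, with the supremum norm. A solution is a function $u\in C^1([t_0,t_f),\mathbb{R}^d)$, $t_f>t_0$, satisfying the equation on $[t_0,t_f)$ with $u(t_0)=\varphi(t_0)$ (and $u=\varphi$ to the left of $t_0$). For $\delta\in(0,\delta_0]$, $|x|=\delta$ and $t^*\geq t_0+kr(\delta)$, $E_{(k)}(\delta,x,t^* )$ is the set of $(\eta_1,\dots,\eta_N)$ with each $\eta_i\in C^{k-1}([-r(\delta),0],B(0,\delta))$ such that: (i) $x\cdot f(t^*,x,\eta_1(0),\dots,\eta_N(0))\geq 0$; and (ii) for some initial function $\varphi\in C$ the delay differential equation has a solution $u$ with $\eta_i(\theta)=u\bigl(t^*+\theta-\tau_i(t^*+\theta,u(t^*+\theta))\bigr)$ for $\theta\in[-r(\delta),0]$ and each $i\in\{1,\dots,N\}$. Lyapunov stable (starting time $t_0$) has its usual meaning: for every $\varepsilon>0$ there is $\rho>0$ such that $\|\varphi\|<\rho$ implies $|u(t)|\leq\varepsilon$ for all $t\geq t_0$.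
   Formalization: Assumption (6) is strengthened: f is of class C^{max(k-2,0)} and each τ_i of class C^{k-1} jointly in time and state, with continuous derivatives; with differentiability only in u and v the claim fails for k=2 (e.g. u'=a u(t-τ(t)), a>0, τ nowhere differentiable). *)

theory Defs
  imports "HOL-Analysis.Analysis"
begin

text \<open>
  The state space is \<open>real ^ 'd\<close>, and the delays are indexed by the finite type \<open>'n\<close>, so that
  \<open>d = CARD('d)\<close> and \<open>N = CARD('n)\<close> are arbitrary positive integers. The delayed arguments
  \<open>(v\<^sub>1, \<dots>, v\<^sub>N)\<close> are collected in one vector of type \<open>(real ^ 'd) ^ 'n\<close>. Functions with a
  restricted domain are total functions of which only the values on that domain are used.
\<close>

text \<open>
  Class \<open>C\<^sup>m\<close> on a set. In finite dimension it makes no difference whether the derivative is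
  required to be \<open>C\<^sup>m\<close> as an operator-valued map or, as here, in every fixed direction \<open>h\<close>.
  The derivative is taken within \<open>S\<close>, hence is one-sided at the end points of an interval.
\<close>

primrec Ck_on :: "nat \<Rightarrow> 'a::real_normed_vector set \<Rightarrow> ('a \<Rightarrow> 'b::real_normed_vector) \<Rightarrow> bool" where
  "Ck_on 0 S f \<longleftrightarrow> continuous_on S f"
| "Ck_on (Suc m) S f \<longleftrightarrow>
     (\<exists>f'. (\<forall>x\<in>S. (f has_derivative f' x) (at x within S)) \<and> (\<forall>h. Ck_on m S (\<lambda>x. f' x h)))"

text \<open>The quantity \<open>r(\<delta>)\<close>.\<close>

definition delay_sup :: "('n \<Rightarrow> real \<Rightarrow> real ^ 'd \<Rightarrow> real) \<Rightarrow> real \<Rightarrow> real \<Rightarrow> real" where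
  "delay_sup \<tau> t0 \<delta> = Sup {\<tau> i t u | i t u. t \<ge> t0 \<and> norm u \<le> \<delta>}"

text \<open>Extended real, so that finiteness of the suprema is not presupposed.\<close>

definition tau_max :: "('n::finite \<Rightarrow> real \<Rightarrow> real ^ 'd \<Rightarrow> real) \<Rightarrow> real \<Rightarrow> ereal" where
  "tau_max \<tau> t0 = Max (range (\<lambda>i. SUP t\<in>{t0..}. ereal (\<tau> i t 0)))"

definition init_funs :: "('n \<Rightarrow> real \<Rightarrow> real ^ 'd \<Rightarrow> real) \<Rightarrow> real \<Rightarrow> real \<Rightarrow> (real \<Rightarrow> real ^ 'd) set" where
  "init_funs \<tau> t0 \<delta>0 = {\<phi>. continuous_on {t0 - delay_sup \<tau> t0 \<delta>0..t0} \<phi>}"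

definition init_norm :: "('n \<Rightarrow> real \<Rightarrow> real ^ 'd \<Rightarrow> real) \<Rightarrow> real \<Rightarrow> real \<Rightarrow> (real \<Rightarrow> real ^ 'd) \<Rightarrow> real" where
  "init_norm \<tau> t0 \<delta>0 \<phi> = (SUP s\<in>{t0 - delay_sup \<tau> t0 \<delta>0..t0}. norm (\<phi> s))"

text \<open>
  \<open>u\<close> is a solution on \<open>[t\<^sub>0, t\<^sub>f)\<close>, where \<open>t\<^sub>f = \<infinity>\<close> is allowed. It is defined on
  \<open>[t\<^sub>0 - r(\<delta>\<^sub>0), t\<^sub>f)\<close>. Outside the ball of radius \<open>\<delta>\<^sub>0\<close> a delay may be negative or exceed
  \<open>r(\<delta>\<^sub>0)\<close>, hence the requirement that the deviated times lie in this domain.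
\<close>

definition dde_solution ::
  "(real \<Rightarrow> real ^ 'd \<Rightarrow> (real ^ 'd) ^ 'n \<Rightarrow> real ^ 'd) \<Rightarrow> ('n \<Rightarrow> real \<Rightarrow> real ^ 'd \<Rightarrow> real) \<Rightarrow>
   real \<Rightarrow> real \<Rightarrow> (real \<Rightarrow> real ^ 'd) \<Rightarrow> ereal \<Rightarrow> (real \<Rightarrow> real ^ 'd) \<Rightarrow> bool" where
  "dde_solution f \<tau> t0 \<delta>0 \<phi> tf u \<longleftrightarrow>
     ereal t0 < tf \<and>
     (\<forall>s\<in>{t0 - delay_sup \<tau> t0 \<delta>0..t0}. u s = \<phi> s) \<and>
     Ck_on 1 {t. t0 \<le> t \<and> ereal t < tf} u \<and>
     (\<forall>t. t0 \<le> t \<and> ereal t < tf \<longrightarrow>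
        (\<forall>i. t0 - delay_sup \<tau> t0 \<delta>0 \<le> t - \<tau> i t (u t) \<and> ereal (t - \<tau> i t (u t)) < tf) \<and>
        (u has_vector_derivative f t (u t) (\<chi> i. u (t - \<tau> i t (u t))))
          (at t within {t. t0 \<le> t \<and> ereal t < tf}))"

text \<open>
  The set \<open>E\<^sub>(\<^sub>k\<^sub>)(\<delta>, x, t\<^sup>*)\<close>. The solution in the last clause has to exist
  at least up to and including time \<open>t\<^sup>*\<close>.
\<close>

definition E_set ::
  "(real \<Rightarrow> real ^ 'd \<Rightarrow> (real ^ 'd) ^ 'n \<Rightarrow> real ^ 'd) \<Rightarrow> ('n \<Rightarrow> real \<Rightarrow> real ^ 'd \<Rightarrow> real) \<Rightarrow>
   real \<Rightarrow> real \<Rightarrow> nat \<Rightarrow> real \<Rightarrow> real ^ 'd \<Rightarrow> real \<Rightarrow> ('n \<Rightarrow> real \<Rightarrow> real ^ 'd) set" where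
  "E_set f \<tau> t0 \<delta>0 k \<delta> x ts =
     {\<eta>. (\<forall>i. Ck_on (k - 1) {- delay_sup \<tau> t0 \<delta>..0} (\<eta> i) \<and>
              \<eta> i ` {- delay_sup \<tau> t0 \<delta>..0} \<subseteq> cball 0 \<delta>) \<and>
         x \<bullet> f ts x (\<chi> i. \<eta> i 0) \<ge> 0 \<and>
         (\<exists>\<phi>\<in>init_funs \<tau> t0 \<delta>0. \<exists>tf u.
            dde_solution f \<tau> t0 \<delta>0 \<phi> tf u \<and> ereal ts < tf \<and>
            (\<forall>\<theta>\<in>{- delay_sup \<tau> t0 \<delta>..0}. \<forall>i.
               \<eta> i \<theta> = u (ts + \<theta> - \<tau> i (ts + \<theta>) (u (ts + \<theta>)))))}"

definition aux_solution ::
  "(real \<Rightarrow> real ^ 'd \<Rightarrow> (real ^ 'd) ^ 'n \<Rightarrow> real ^ 'd) \<Rightarrow> ('n \<Rightarrow> real \<Rightarrow> real ^ 'd \<Rightarrow> real) \<Rightarrow>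
   real ^ 'd \<Rightarrow> real \<Rightarrow> ('n \<Rightarrow> real \<Rightarrow> real ^ 'd) \<Rightarrow> 'n \<Rightarrow> (real \<Rightarrow> real ^ 'd) \<Rightarrow> bool" where
  "aux_solution f \<tau> x ts \<eta> i v \<longleftrightarrow>
     v (- \<tau> i ts x) = \<eta> i 0 \<and>
     (\<forall>\<theta>\<in>{- \<tau> i ts x..0}.
        (v has_vector_derivative f (ts + \<theta>) (v \<theta>) (\<chi> j. \<eta> j \<theta>)) (at \<theta> within {- \<tau> i ts x..0}))"

text \<open>
  ``The solution \<open>u\<close> with initial function \<open>\<phi>\<close> satisfies \<open>|u(t)| \<le> \<epsilon>\<close> for all \<open>t \<ge> t\<^sub>0\<close>.''
  Initial functions are merely continuous, so solutions need not be unique. The claim is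
  therefore made about all of them. That it holds for all \<open>t \<ge> t\<^sub>0\<close> includes global existence:
  there is a solution, and each solution on some \<open>[t\<^sub>0, t\<^sub>f)\<close> is the restriction of one on
  \<open>[t\<^sub>0, \<infinity>)\<close>.
\<close>

definition solution_bounded_by ::
  "(real \<Rightarrow> real ^ 'd \<Rightarrow> (real ^ 'd) ^ 'n \<Rightarrow> real ^ 'd) \<Rightarrow> ('n \<Rightarrow> real \<Rightarrow> real ^ 'd \<Rightarrow> real) \<Rightarrow>
   real \<Rightarrow> real \<Rightarrow> (real \<Rightarrow> real ^ 'd) \<Rightarrow> real \<Rightarrow> bool" where
  "solution_bounded_by f \<tau> t0 \<delta>0 \<phi> \<epsilon> \<longleftrightarrow>
     (\<exists>tf u. dde_solution f \<tau> t0 \<delta>0 \<phi> tf u) \<and>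
     (\<forall>tf u. dde_solution f \<tau> t0 \<delta>0 \<phi> tf u \<longrightarrow>
        (\<exists>w. dde_solution f \<tau> t0 \<delta>0 \<phi> \<infinity> w \<and>
             (\<forall>t\<ge>t0. ereal t < tf \<longrightarrow> w t = u t) \<and>
             (\<forall>t\<ge>t0. norm (w t) \<le> \<epsilon>)))"

definition lyapunov_stable ::
  "(real \<Rightarrow> real ^ 'd \<Rightarrow> (real ^ 'd) ^ 'n \<Rightarrow> real ^ 'd) \<Rightarrow> ('n \<Rightarrow> real \<Rightarrow> real ^ 'd \<Rightarrow> real) \<Rightarrow>
   real \<Rightarrow> real \<Rightarrow> bool" where
  "lyapunov_stable f \<tau> t0 \<delta>0 \<longleftrightarrow>
     (\<forall>\<epsilon>>0. \<exists>\<rho>>0. \<forall>\<phi>\<in>init_funs \<tau> t0 \<delta>0.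
        init_norm \<tau> t0 \<delta>0 \<phi> < \<rho> \<longrightarrow> solution_bounded_by f \<tau> t0 \<delta>0 \<phi> \<epsilon>)"

text \<open>
  The differentiability assumption: \<open>f\<close> of class \<open>C\<^sup>m\<close> with \<open>m = max (k - 2) 0\<close> and \<open>\<tau>\<^sub>i\<close> of
  class \<open>C\<^sup>k\<^sup>-\<^sup>1\<close> (subtraction on \<^typ>\<open>nat\<close> truncates). Differentiability is joint in time and
  state. Its purpose is that \<open>\<theta> \<mapsto> u (t\<^sup>* + \<theta> - \<tau>\<^sub>i (t\<^sup>* + \<theta>, u (t\<^sup>* + \<theta>)))\<close> is of class
  \<open>C\<^sup>k\<^sup>-\<^sup>1\<close> for every solution \<open>u\<close>, as membership in \<open>E\<^sub>(\<^sub>k\<^sub>)\<close> requires. Differentiability in the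
  state variables alone does not give this if \<open>k \<ge> 2\<close>: for \<open>u'(t) = a u(t - \<tau>(t))\<close> with \<open>a > 0\<close>
  and a nowhere differentiable \<open>\<tau>\<close> the set \<open>E\<^sub>(\<^sub>2\<^sub>)\<close> can reduce to \<open>{0}\<close> although the zero
  solution is unstable. For \<open>k = 1\<close> the assumption is plain continuity.
\<close>

definition dde_smooth ::
  "(real \<Rightarrow> real ^ 'd \<Rightarrow> (real ^ 'd) ^ 'n \<Rightarrow> real ^ 'd) \<Rightarrow> ('n \<Rightarrow> real \<Rightarrow> real ^ 'd \<Rightarrow> real) \<Rightarrow>
   real \<Rightarrow> nat \<Rightarrow> bool" where
  "dde_smooth f \<tau> t0 k \<longleftrightarrow>
     Ck_on (k - 2) ({t0..} \<times> UNIV \<times> UNIV) (\<lambda>(t, u, v). f t u v) \<and>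
     (\<forall>i. Ck_on (k - 1) ({t0..} \<times> UNIV) (\<lambda>(t, u). \<tau> i t u))"

end

theory Submission
  imports Defs "HOL-Complex_Analysis.Great_Picard"
begin

text \<open>
  Gronwall's argument keeps \<open>|u| < \<delta>\<close> up to time \<open>t\<^sub>0 + k r(\<delta>)\<close>. Afterwards \<open>|u|\<^sup>2\<close> is compared with
  the slowly increasing barrier \<open>\<delta>\<^sup>2 + \<epsilon> (t - a)\<close>. At the first time \<open>c\<close> of contact, \<open>u\<close> is at its largest
  so far, and the derivative of \<open>|u|\<^sup>2\<close> would have to be at least \<open>\<epsilon> > 0\<close>. Hence the delayed segments of
  \<open>u\<close> at \<open>c\<close> belong to \<open>E\<^sub>(\<^sub>k\<^sub>)(|u(c)|, u(c), c)\<close>, and by uniqueness the auxiliary solution is \<open>u(c + \<theta>)\<close>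
  itself. Its value at \<open>0\<close> is \<open>u(c)\<close>, so only the second alternative of the hypothesis can hold, and that
  one says that the derivative is nonpositive. The contact radius exceeds \<open>\<delta>\<close>; this is harmless because
  \<open>r\<close> is continuous.

  Solutions exist by Peano's theorem for the equation truncated to a slightly larger ball, which the
  a priori bound prevents the solution from leaving.
\<close>

text \<open>At contact the hypothesis gives only a nonpositive derivative, which does not rule out a
  later crossing of the constant level \<open>\<delta>^2\<close>; against a barrier of positive
  slope it is a contradiction. The price is that the contact radius is not known in advance. The
  waiting time is therefore \<open>k r(\<delta>2)\<close> with a fixed
  \<open>\<delta>2 > \<delta>\<close> above all possible contact radii, and the strict smallness of
  the initial function has to survive the passage from \<open>r(\<delta>)\<close> to
  \<open>r(\<delta>2)\<close>.

  The factor \<open>k\<close> is a count of derivatives. A solution starts merely continuous on the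
  initial interval and, through the equation, gains one derivative per period
  \<open>r(\<delta>)\<close>; looking back by a delay costs a further period, and so does the length
  of the segment.

  Two obstacles shape the rest. \<open>f\<close> is Lipschitz only near \<open>0\<close>, while the
  auxiliary solution in the hypothesis might leave that region, so uniqueness has to include
  confinement. And solutions need not be unique, so every given solution must be bounded and
  extended; constructing one good solution is not enough.\<close>

section \<open>Comparison with a barrier, local uniqueness for ODEs, removable points\<close>

text \<open>At a first contact \<open>w - g\<close> vanishes; a positive derivative there would make
  it negative just before. The premise \<open>touch\<close> may use that the whole past lies below
  the barrier, which is what an equation with delays requires.\<close>

lemma strict_barrier:
  fixes g w g' w' :: "real \<Rightarrow> real"
  assumes "a \<le> T" and init: "g a < w a"
    and g: "\<And>t. a \<le> t \<Longrightarrow> t \<le> T \<Longrightarrow> (g has_real_derivative g' t) (at t within {a..T})"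
    and w: "\<And>t. a \<le> t \<Longrightarrow> t \<le> T \<Longrightarrow> (w has_real_derivative w' t) (at t within {a..T})"
    and touch: "\<And>t. a < t \<Longrightarrow> t \<le> T \<Longrightarrow> (\<And>s. a \<le> s \<Longrightarrow> s < t \<Longrightarrow> g s < w s) \<Longrightarrow> g t = w t \<Longrightarrow> g' t < w' t"
  shows "g T < w T"
proof (rule ccontr)
  assume "\<not> g T < w T"
  define h where "h = (\<lambda>t. w t - g t)"
  have deriv: "(h has_real_derivative w' t - g' t) (at t within {a..T})" if "a \<le> t" "t \<le> T" for t
    unfolding h_def using w[OF that] g[OF that] by (rule DERIV_diff)
  then have cont: "continuous_on {a..T} h"
    by (intro DERIV_continuous_on[where D = "\<lambda>t. w' t - g' t"]) auto
  define Z where "Z = {a..T} \<inter> h -` {..0}"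
  have "closed Z"
    unfolding Z_def using cont by (intro continuous_closed_preimage) auto
  moreover have "T \<in> Z" "bdd_below Z"
    using \<open>\<not> g T < w T\<close> \<open>a \<le> T\<close> by (auto simp: Z_def h_def)
  ultimately have "Inf Z \<in> Z"
    by (intro closed_contains_Inf) auto
  define c where "c = Inf Z"
  have c: "a \<le> c" "c \<le> T" "h c \<le> 0"
    using \<open>Inf Z \<in> Z\<close> by (auto simp: Z_def c_def)
  have before: "0 < h s" if "a \<le> s" "s < c" for s
  proof (rule ccontr)
    assume "\<not> 0 < h s"
    then have "s \<in> Z" using that c by (auto simp: Z_def)
    then show False using cInf_lower[OF _ \<open>bdd_below Z\<close>] that(2) by (fastforce simp: c_def)
  qed
  have "h a > 0" using init by (simp add: h_def)
  then have "a < c" using c by (cases "a = c") auto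
  obtain z where z: "a \<le> z" "z \<le> c" "h z = 0"
    using IVT2'[of h c 0 a] c \<open>h a > 0\<close> continuous_on_subset[OF cont] by auto
  then have "h c = 0" using before[of z] by (cases "z = c") auto
  then have "0 < w' c - g' c"
    using touch[of c] before \<open>a < c\<close> c by (auto simp: h_def)
  then obtain d where d: "d > 0" "\<And>e. e > 0 \<Longrightarrow> c - e \<in> {a..T} \<Longrightarrow> e < d \<Longrightarrow> h (c - e) < h c"
    using has_real_derivative_pos_inc_left[OF deriv[OF c(1,2)]] by blast
  define e where "e = min (d/2) (c - a)"
  have "0 < e" "e < d" "e \<le> c - a" using d(1) \<open>a < c\<close> by (auto simp: e_def)
  then have "h (c - e) < h c" using c by (intro d(2)) auto
  then show False using before[of "c - e"] \<open>h c = 0\<close> \<open>0 < e\<close> \<open>e \<le> c - a\<close> by auto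
qed

lemma has_real_derivative_norm_square:
  fixes u :: "real \<Rightarrow> 'a::real_inner"
  assumes "(u has_vector_derivative u') (at t within S)"
  shows "((\<lambda>t. (norm (u t))\<^sup>2) has_real_derivative 2 * (u t \<bullet> u')) (at t within S)"
  using bounded_bilinear.has_vector_derivative[OF bounded_bilinear_inner assms assms]
  by (simp add: has_real_derivative_iff_has_vector_derivative power2_norm_eq_inner inner_commute)

text \<open>A Gronwall estimate for \<open>|v - y|^2\<close> needs both solutions in the ball of
  radius \<open>R\<close>, but only \<open>y\<close> is known to be there, and in a smaller ball.
  The gap \<open>R - \<rho>\<close> is the room in which \<open>v\<close> is confined by the same
  estimate.\<close>

lemma ode_unique_in_ball:
  fixes v y :: "real \<Rightarrow> 'a::real_inner"
  assumes "a \<le> b" "\<rho> < R" "0 \<le> K" "v a = y a"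
    and v: "\<And>t. t \<in> {a..b} \<Longrightarrow> (v has_vector_derivative H t (v t)) (at t within {a..b})"
    and y: "\<And>t. t \<in> {a..b} \<Longrightarrow> (y has_vector_derivative H t (y t)) (at t within {a..b})"
    and y_ball: "\<And>t. t \<in> {a..b} \<Longrightarrow> norm (y t) \<le> \<rho>"
    and lip: "\<And>t p q. t \<in> {a..b} \<Longrightarrow> norm p \<le> R \<Longrightarrow> norm q \<le> R \<Longrightarrow> norm (H t p - H t q) \<le> K * norm (p - q)"
  shows "v b = y b"
proof (rule ccontr)
  assume "v b \<noteq> y b"
  \<comment> \<open>\<open>v\<close> is not known to stay in the ball; below the barrier \<open>w\<close> it does.\<close>
  define g where "g t = (norm (v t - y t))\<^sup>2" for t
  \<comment> \<open>Since \<open>w b = m\<close>, the bound \<open>m \<le> g b\<close> makes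
    \<open>g b < w b\<close> absurd; the bound by \<open>(R - \<rho>)^2\<close> puts
    \<open>v\<close> into the ball at any contact.\<close>
  define m where "m = min ((R - \<rho>)\<^sup>2) (g b)"
  \<comment> \<open>The Lipschitz bound lets \<open>g\<close> grow at rate at most
    \<open>2 * K\<close>; the extra \<open>1\<close> makes the comparison strict.\<close>
  define w where "w t = m * exp ((2 * K + 1) * (t - b))" for t
  have "0 < m" using \<open>v b \<noteq> y b\<close> \<open>\<rho> < R\<close> by (simp add: m_def g_def)
  have "g b < w b"
  proof (rule strict_barrier[OF \<open>a \<le> b\<close>])
    show "g a < w a" using \<open>v a = y a\<close> \<open>0 < m\<close> by (simp add: g_def w_def)
    show "(g has_real_derivative 2 * ((v t - y t) \<bullet> (H t (v t) - H t (y t)))) (at t within {a..b})"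
      if "a \<le> t" "t \<le> b" for t
      unfolding g_def[abs_def] using that
      by (intro has_real_derivative_norm_square has_vector_derivative_diff v y) auto
    show "(w has_real_derivative (2 * K + 1) * w t) (at t within {a..b})" for t
      unfolding w_def[abs_def] by (auto intro!: derivative_eq_intros)
    fix t assume t: "a < t" "t \<le> b" and eq: "g t = w t"
    have "w t \<le> m * 1" unfolding w_def using t \<open>0 < m\<close> \<open>0 \<le> K\<close>
      by (intro mult_left_mono) (auto intro!: mult_nonneg_nonpos)
    then have "(norm (v t - y t))\<^sup>2 \<le> (R - \<rho>)\<^sup>2" using eq by (simp add: g_def m_def)
    then have "norm (v t - y t) \<le> R - \<rho>" using \<open>\<rho> < R\<close> by (auto intro: power2_le_imp_le)
    then have ball: "norm (v t) \<le> R" "norm (y t) \<le> R"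
      using y_ball[of t] t norm_triangle_sub[of "v t" "y t"] \<open>\<rho> < R\<close> by auto
    have "(v t - y t) \<bullet> (H t (v t) - H t (y t)) \<le> norm (v t - y t) * norm (H t (v t) - H t (y t))"
      by (rule norm_cauchy_schwarz)
    also have "\<dots> \<le> norm (v t - y t) * (K * norm (v t - y t))"
      using t ball by (intro mult_left_mono lip) auto
    finally have "2 * ((v t - y t) \<bullet> (H t (v t) - H t (y t))) \<le> 2 * K * g t"
      by (simp add: g_def power2_eq_square mult_ac)
    also have "\<dots> < (2 * K + 1) * w t"
      using \<open>0 < m\<close> by (simp add: eq w_def algebra_simps)
    finally show "2 * ((v t - y t) \<bullet> (H t (v t) - H t (y t))) < (2 * K + 1) * w t" .
  qed
  then show False by (simp add: w_def m_def)
qed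

text \<open>Used where a new piece of solution is glued to an old one at \<open>c\<close>, and at
  the end points. By the fundamental theorem of calculus \<open>w\<close> is the integral of the
  continuous \<open>R\<close>, hence differentiable at the omitted points too.\<close>

lemma has_vector_derivative_removable:
  fixes w R :: "real \<Rightarrow> 'a::banach"
  assumes "continuous_on {a..b} w" "continuous_on {a..b} R"
    and deriv: "\<And>t. a < t \<Longrightarrow> t < b \<Longrightarrow> t \<noteq> c \<Longrightarrow> (w has_vector_derivative R t) (at t)"
    and "t \<in> {a..b}"
  shows "(w has_vector_derivative R t) (at t within {a..b})"
proof -
  have w: "w s = w a + integral {a..s} R" if "s \<in> {a..b}" for s
  proof -
    have "(R has_integral (w s - w a)) {a..s}"
      using that assms(1) deriv
      by (intro fundamental_theorem_of_calculus_interior_strong[of "{c}"]) (auto intro: continuous_on_subset)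
    then show ?thesis by (simp add: integral_unique)
  qed
  have "((\<lambda>s. w a + integral {a..s} R) has_vector_derivative 0 + R t) (at t within {a..b})"
    using assms by (intro has_vector_derivative_add has_vector_derivative_const integral_has_vector_derivative)
  then have "((\<lambda>s. w a + integral {a..s} R) has_vector_derivative R t) (at t within {a..b})" by simp
  then show ?thesis
    by (rule has_vector_derivative_transform[rotated 2]) (rule \<open>t \<in> {a..b}\<close>, rule w)
qed

section \<open>Calculus of \<open>C\<^sup>m\<close> maps\<close>

lemma Ck_on_imp_continuous_on: "Ck_on m S f \<Longrightarrow> continuous_on S f"
  by (cases m) (auto simp: continuous_on_eq_continuous_within intro: has_derivative_continuous)

lemma Ck_on_cong:
  assumes "Ck_on m S f" "\<And>x. x \<in> S \<Longrightarrow> g x = f x"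
  shows "Ck_on m S g"
proof (cases m)
  case 0
  then show ?thesis using assms by (simp cong: continuous_on_cong)
next
  case (Suc n)
  with assms(1) obtain f' where "\<forall>x\<in>S. (f has_derivative f' x) (at x within S)" "\<forall>h. Ck_on n S (\<lambda>x. f' x h)"
    by auto
  moreover from this have "\<forall>x\<in>S. (g has_derivative f' x) (at x within S)"
    using assms(2) by (metis has_derivative_transform)
  ultimately show ?thesis using Suc by auto
qed

lemma Ck_on_SucD: "Ck_on (Suc m) S f \<Longrightarrow> Ck_on m S f"
proof (induction m arbitrary: f)
  case 0
  then show ?case using Ck_on_imp_continuous_on[of 1 S f] by simp
next
  case (Suc m)
  from Suc.prems obtain f' where "\<forall>x\<in>S. (f has_derivative f' x) (at x within S)" "\<forall>h. Ck_on (Suc m) S (\<lambda>x. f' x h)"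
    unfolding Ck_on.simps(2)[of "Suc m"] by blast
  with Suc.IH show ?case by auto
qed

lemma Ck_on_le: "Ck_on n S f \<Longrightarrow> m \<le> n \<Longrightarrow> Ck_on m S f"
  by (induction n) (auto simp del: Ck_on.simps simp: le_Suc_eq intro: Ck_on_SucD)

lemma Ck_on_subset: "Ck_on m S f \<Longrightarrow> T \<subseteq> S \<Longrightarrow> Ck_on m T f"
proof (induction m arbitrary: f)
  case 0
  then show ?case by (auto intro: continuous_on_subset)
next
  case (Suc m)
  then obtain f' where "\<forall>x\<in>S. (f has_derivative f' x) (at x within S)" "\<forall>h. Ck_on m S (\<lambda>x. f' x h)"
    by auto
  then show ?case using Suc.IH Suc.prems(2) has_derivative_subset
    by (auto intro!: exI[of _ f'] dest: subsetD) blast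
qed

lemma Ck_on_const: "Ck_on m S (\<lambda>x. c)"
proof (induction m arbitrary: c)
  case (Suc m)
  then show ?case by (auto intro!: exI[of _ "\<lambda>x h. 0"])
qed simp

lemma Ck_on_bounded_linear:
  assumes "bounded_linear A" "Ck_on m S f"
  shows "Ck_on m S (\<lambda>x. A (f x))"
  using assms(2)
proof (induction m arbitrary: f)
  case 0
  then show ?case using assms(1)
    by (simp add: bounded_linear.continuous_on)
next
  case (Suc m)
  then obtain f' where "\<forall>x\<in>S. (f has_derivative f' x) (at x within S)" "\<forall>h. Ck_on m S (\<lambda>x. f' x h)"
    by auto
  with Suc.IH show ?case
    by (auto intro!: exI[of _ "\<lambda>x h. A (f' x h)"] bounded_linear.has_derivative[OF assms(1)])
qed

lemma Ck_on_add:
  assumes "Ck_on m S f" "Ck_on m S g"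
  shows "Ck_on m S (\<lambda>x. f x + g x)"
  using assms
proof (induction m arbitrary: f g)
  case 0
  then show ?case by (auto intro: continuous_intros)
next
  case (Suc m)
  then obtain f' g' where "\<forall>x\<in>S. (f has_derivative f' x) (at x within S)" "\<forall>h. Ck_on m S (\<lambda>x. f' x h)"
    "\<forall>x\<in>S. (g has_derivative g' x) (at x within S)" "\<forall>h. Ck_on m S (\<lambda>x. g' x h)"
    by auto
  with Suc.IH show ?case
    by (auto intro!: exI[of _ "\<lambda>x h. f' x h + g' x h"] derivative_intros)
qed

lemma Ck_on_sum:
  assumes "finite I" "\<And>i. i \<in> I \<Longrightarrow> Ck_on m S (f i)"
  shows "Ck_on m S (\<lambda>x. \<Sum>i\<in>I. f i x)"
  using assms by (induction I rule: finite_induct) (auto intro: Ck_on_const Ck_on_add)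

lemma Ck_on_scaleR:
  assumes "Ck_on m S f" "Ck_on m S g"
  shows "Ck_on m S (\<lambda>x. f x *\<^sub>R g x)"
  using assms
proof (induction m arbitrary: f g)
  case 0
  then show ?case by (auto intro: continuous_intros)
next
  case (Suc m)
  then obtain f' g' where "\<forall>x\<in>S. (f has_derivative f' x) (at x within S)" "\<forall>h. Ck_on m S (\<lambda>x. f' x h)"
    "\<forall>x\<in>S. (g has_derivative g' x) (at x within S)" "\<forall>h. Ck_on m S (\<lambda>x. g' x h)"
    by auto
  moreover have "Ck_on m S f" "Ck_on m S g" using Suc.prems Ck_on_SucD by blast+
  ultimately show ?case using Suc.IH
    by (auto intro!: exI[of _ "\<lambda>x h. f x *\<^sub>R g' x h + f' x h *\<^sub>R g x"] Ck_on_add has_derivative_scaleR)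
qed

text \<open>In the chain rule the direction \<open>f' x h\<close> moves with \<open>x\<close>,
  whereas \<open>Ck_on\<close> controls the derivative of \<open>g\<close> only in fixed directions.
  Expanding the direction in \<open>Basis\<close> leaves finitely many fixed ones, with coefficients
  of class \<open>Ck_on m\<close>.\<close>

lemma Ck_on_compose:
  fixes f :: "'a::real_normed_vector \<Rightarrow> 'b::euclidean_space" and g :: "'b \<Rightarrow> 'c::real_normed_vector"
  assumes "Ck_on m T g" "Ck_on m S f" "f ` S \<subseteq> T"
  shows "Ck_on m S (\<lambda>x. g (f x))"
  using assms
proof (induction m arbitrary: f g)
  case 0
  then show ?case by (auto intro: continuous_on_compose2)
next
  case (Suc m)
  then obtain f' g' where f': "\<And>x. x \<in> S \<Longrightarrow> (f has_derivative f' x) (at x within S)" "\<And>h. Ck_on m S (\<lambda>x. f' x h)"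
    and g': "\<And>y. y \<in> T \<Longrightarrow> (g has_derivative g' y) (at y within T)" "\<And>h. Ck_on m T (\<lambda>y. g' y h)"
    by (metis Ck_on.simps(2))
  have "Ck_on m S (\<lambda>x. g' (f x) (f' x h))" for h
  proof (rule Ck_on_cong)
    show "Ck_on m S (\<lambda>x. \<Sum>b\<in>Basis. (f' x h \<bullet> b) *\<^sub>R g' (f x) b)"
      using Suc.prems
      by (intro Ck_on_sum Ck_on_scaleR Ck_on_bounded_linear[OF bounded_linear_inner_left] Suc.IH f' g')
        (auto intro: Ck_on_SucD simp del: Ck_on.simps)
    fix x assume "x \<in> S"
    then have "linear (g' (f x))"
      using Suc.prems(3) g'(1) has_derivative_linear by blast
    then have "g' (f x) (\<Sum>b\<in>Basis. (f' x h \<bullet> b) *\<^sub>R b) = (\<Sum>b\<in>Basis. (f' x h \<bullet> b) *\<^sub>R g' (f x) b)"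
      by (simp add: linear_sum linear_scale)
    then show "g' (f x) (f' x h) = (\<Sum>b\<in>Basis. (f' x h \<bullet> b) *\<^sub>R g' (f x) b)"
      by (simp add: euclidean_representation)
  qed
  moreover have "((\<lambda>x. g (f x)) has_derivative (\<lambda>h. g' (f x) (f' x h))) (at x within S)" if "x \<in> S" for x
    using g'(1) Suc.prems(3) that f'(1)[OF that] by (rule has_derivative_in_compose2)
  ultimately show ?case by (auto intro!: exI[of _ "\<lambda>x h. g' (f x) (f' x h)"])
qed

lemma Ck_on_Pair:
  fixes f :: "'a::real_normed_vector \<Rightarrow> 'b::real_normed_vector" and g :: "'a \<Rightarrow> 'c::real_normed_vector"
  assumes "Ck_on m S f" "Ck_on m S g"
  shows "Ck_on m S (\<lambda>x. (f x, g x))"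
proof -
  have "Ck_on m S (\<lambda>x. (f x, 0) + (0, g x))"
    by (intro Ck_on_add Ck_on_bounded_linear[of "\<lambda>y. (y, 0)"] Ck_on_bounded_linear[of "\<lambda>y. (0, y)"] assms
        bounded_linear_Pair bounded_linear_ident bounded_linear_zero)
  then show ?thesis by simp
qed

lemma Ck_on_vec_lambda:
  fixes f :: "'n::finite \<Rightarrow> 'a::real_normed_vector \<Rightarrow> 'b::euclidean_space"
  assumes "\<And>i. Ck_on m S (f i)"
  shows "Ck_on m S (\<lambda>x. \<chi> i. f i x)"
proof -
  have "bounded_linear (\<lambda>y::'b. axis i y :: 'b ^ 'n)" for i
    by (intro linear_conv_bounded_linear[THEN iffD1] linearI) (auto simp: axis_def vec_eq_iff)
  then have "Ck_on m S (\<lambda>x. \<Sum>i\<in>UNIV. axis i (f i x))"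
    by (intro Ck_on_sum Ck_on_bounded_linear[of "axis _"] assms) auto
  moreover have "(\<Sum>i\<in>UNIV. axis i (f i x)) = (\<chi> i. f i x)" for x
    by (simp add: vec_eq_iff axis_def if_distrib cong: if_cong)
  ultimately show ?thesis by simp
qed

lemma Ck_on_ident: "Ck_on m S (\<lambda>x. x)"
proof (cases m)
  case (Suc n)
  then show ?thesis by (auto intro!: exI[of _ "\<lambda>x h. h"] Ck_on_const)
qed simp

text \<open>The bootstrap step: a differential equation makes its solution one order smoother than
  its right-hand side.\<close>

lemma Ck_on_Suc_vector_derivative:
  assumes "\<And>t. t \<in> S \<Longrightarrow> (u has_vector_derivative u' t) (at t within S)" "Ck_on m S u'"
  shows "Ck_on (Suc m) S u"
  using assms by (auto simp: has_vector_derivative_def intro!: exI[of _ "\<lambda>t h. h *\<^sub>R u' t"] Ck_on_scaleR Ck_on_const)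

lemma Ck_on_diff: "Ck_on m S f \<Longrightarrow> Ck_on m S g \<Longrightarrow> Ck_on m S (\<lambda>x. f x - g x)"
  using Ck_on_add[OF _ Ck_on_bounded_linear[OF bounded_linear_minus[OF bounded_linear_ident]]] by fastforce

section \<open>Peano existence for state-dependent delays\<close>

text \<open>Evaluation along a whole trajectory; one notation serves the original equation, the
  truncated one and the approximations.\<close>

definition delay_rhs ::
  "(real \<Rightarrow> 'a \<Rightarrow> 'a ^ 'n \<Rightarrow> 'b) \<Rightarrow> ('n \<Rightarrow> real \<Rightarrow> 'a \<Rightarrow> real) \<Rightarrow> (real \<Rightarrow> 'a) \<Rightarrow> real \<Rightarrow> 'b" where
  "delay_rhs f \<tau> u t = f t (u t) (\<chi> i. u (t - \<tau> i t (u t)))"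

lemma delay_rhs_cong:
  assumes "u t = w t" "\<And>i. u (t - \<tau> i t (w t)) = w (t - \<tau> i t (w t))"
  shows "delay_rhs f \<tau> u t = delay_rhs f \<tau> w t"
  using assms by (simp add: delay_rhs_def)

lemma continuous_on_delay_rhs:
  fixes f :: "real \<Rightarrow> 'a::real_normed_vector \<Rightarrow> 'a ^ 'n::finite \<Rightarrow> 'b::real_normed_vector"
  assumes f: "continuous_on (D \<times> UNIV \<times> UNIV) (\<lambda>(t, u, v). f t u v)"
    and \<tau>: "\<And>i. continuous_on (D \<times> UNIV) (\<lambda>(t, u). \<tau> i t u)"
    and u: "continuous_on S u" and "T \<subseteq> S" "T \<subseteq> D" "\<And>t i. t \<in> T \<Longrightarrow> t - \<tau> i t (u t) \<in> S"
  shows "continuous_on T (delay_rhs f \<tau> u)"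
proof -
  have uT: "continuous_on T u" using u \<open>T \<subseteq> S\<close> by (rule continuous_on_subset)
  have "continuous_on T (\<lambda>t. \<tau> i t (u t))" for i
    using continuous_on_compose2[OF \<tau> continuous_on_Pair[OF continuous_on_id uT], of i] \<open>T \<subseteq> D\<close>
    by auto
  then have "continuous_on T (\<lambda>t. u (t - \<tau> i t (u t)))" for i
    using assms(6) by (intro continuous_on_compose2[OF u] continuous_intros) auto
  then have "continuous_on T (\<lambda>t. (t, u t, \<chi> i. u (t - \<tau> i t (u t))))"
    using uT by (intro continuous_intros)
  then show ?thesis
    using continuous_on_compose2[OF f, of T "\<lambda>t. (t, u t, \<chi> i. u (t - \<tau> i t (u t)))"] \<open>T \<subseteq> D\<close>
    by (auto simp: delay_rhs_def[abs_def])
qed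

text \<open>Left of \<open>a\<close> the interval is empty and the integral is \<open>0\<close>, so
  the estimate holds on the whole line. This is convenient because the upper limit will be shifted
  back by \<open>h\<close>.\<close>

lemma indefinite_integral_lipschitz:
  fixes F :: "real \<Rightarrow> 'a::banach"
  assumes cont: "continuous_on {a..} F" and M: "\<And>t. t \<ge> a \<Longrightarrow> norm (F t) \<le> M"
  shows "M-lipschitz_on UNIV (\<lambda>t. integral {a..t} F)"
proof (rule lipschitz_onI)
  show "0 \<le> M" using M[of a] norm_ge_zero[of "F a"] by linarith
  have le: "norm (integral {a..y} F - integral {a..x} F) \<le> M * (y - x)" if "x \<le> y" for x y
  proof (cases "a \<le> x")
    case True
    have "F integrable_on {a..y}"
      using continuous_on_subset[OF cont] by (intro integrable_continuous_real) auto
    then have "integral {a..y} F - integral {a..x} F = integral {x..y} F"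
      using Henstock_Kurzweil_Integration.integral_combine[of a x y F] True that by (simp add: algebra_simps)
    also have "norm \<dots> \<le> M * (y - x)"
      using that True by (intro integral_bound continuous_on_subset[OF cont] M) auto
    finally show ?thesis .
  next
    case False
    have "norm (integral {a..y} F) \<le> M * (y - x)"
    proof (cases "a \<le> y")
      case True
      then have "norm (integral {a..y} F) \<le> M * (y - a)"
        by (intro integral_bound continuous_on_subset[OF cont] M) auto
      also have "\<dots> \<le> M * (y - x)" using False \<open>0 \<le> M\<close> by (intro mult_left_mono) auto
      finally show ?thesis .
    qed (use that \<open>0 \<le> M\<close> in auto)
    then show ?thesis using False by simp
  qed
  show "dist (integral {a..x} F) (integral {a..y} F) \<le> M * dist x y" for x y
    using le[of x y] le[of y x] by (cases "x \<le> y") (auto simp: dist_norm norm_minus_commute abs_real_def)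
qed

lemma convergent_on_dense_lipschitz:
  fixes z :: "nat \<Rightarrow> real \<Rightarrow> 'a::banach"
  assumes lip: "\<And>n. M-lipschitz_on UNIV (z n)" and conv: "\<And>q. q \<in> \<rat> \<Longrightarrow> convergent (\<lambda>n. z n q)"
  shows "convergent (\<lambda>n. z n t)"
proof -
  have "0 \<le> M" using lip lipschitz_on_nonneg by blast
  have "Cauchy (\<lambda>n. z n t)"
  proof (rule metric_CauchyI)
    fix e :: real assume "0 < e"
    define d where "d = e / (3 * (M + 1))"
    have "0 < d" using \<open>0 < e\<close> \<open>0 \<le> M\<close> by (auto simp: d_def)
    then obtain q where q: "q \<in> \<rat>" "t < q" "q < t + d"
      using Rats_dense_in_real[of t "t + d"] by auto
    have "M * \<bar>t - q\<bar> \<le> M * d" using q \<open>0 \<le> M\<close> by (intro mult_left_mono) auto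
    also have "\<dots> \<le> e / 3" using \<open>0 \<le> M\<close> \<open>0 < e\<close> by (auto simp: d_def field_simps)
    finally have near: "dist (z n t) (z n q) \<le> e / 3" for n
      using lipschitz_onD[OF lip, of t q n] by (auto simp: dist_real_def)
    have "Cauchy (\<lambda>n. z n q)" using conv q(1) convergent_Cauchy by blast
    then obtain N where N: "\<And>m n. m \<ge> N \<Longrightarrow> n \<ge> N \<Longrightarrow> dist (z m q) (z n q) < e / 3"
      using metric_CauchyD[of _ "e / 3"] \<open>0 < e\<close> by fastforce
    have "dist (z m t) (z n t) < e" if "m \<ge> N" "n \<ge> N" for m n
    proof -
      have "dist (z m t) (z n t) \<le> dist (z m t) (z m q) + (dist (z m q) (z n q) + dist (z n q) (z n t))"
        using dist_triangle[of "z m t" "z n t" "z m q"] dist_triangle[of "z m q" "z n t" "z n q"] by linarith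
      also have "\<dots> < e" using near[of m] near[of n] N[OF that] by (simp add: dist_commute)
      finally show ?thesis .
    qed
    then show "\<exists>N. \<forall>m\<ge>N. \<forall>n\<ge>N. dist (z m t) (z n t) < e" by blast
  qed
  then show ?thesis by (rule Cauchy_convergent)
qed

text \<open>The part of Arzela-Ascoli that Peano's theorem uses: a diagonal subsequence converges on
  the rationals, and the common Lipschitz constant carries this to all points. Pointwise limits
  suffice, since the same constant later handles moving arguments.\<close>

lemma equilipschitz_convergent_subsequence:
  fixes z :: "nat \<Rightarrow> real \<Rightarrow> 'a::euclidean_space"
  assumes lip: "\<And>n. M-lipschitz_on UNIV (z n)" and zero: "\<And>n. z n a = 0"
  obtains k :: "nat \<Rightarrow> nat" and Z where "strict_mono k" "\<And>t. (\<lambda>n. z (k n) t) \<longlonglongrightarrow> Z t"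
proof -
  have "0 \<le> M" using lip lipschitz_on_nonneg by blast
  \<comment> \<open>The diagonal argument wants one bound for all points, but \<open>|z n q|\<close>
    may grow linearly in \<open>q\<close>. Dividing by this weight makes the values at most
    \<open>1\<close>.\<close>
  define c where "c q = 1 + M * \<bar>q - a\<bar>" for q
  have c: "c q > 0" for q using \<open>0 \<le> M\<close> by (simp add: c_def add_pos_nonneg)
  have bound: "norm ((1 / c q) *\<^sub>R z n q) \<le> 1" for n q
    using lipschitz_onD[OF lip, of q a n] zero c[of q] by (auto simp: dist_norm c_def divide_simps)
  obtain k where k: "strict_mono (k :: nat \<Rightarrow> nat)"
      "\<And>q. q \<in> \<rat> \<Longrightarrow> \<exists>l. (\<lambda>n. (1 / c q) *\<^sub>R z (k n) q) \<longlonglongrightarrow> l"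
  proof (rule function_convergent_subsequence[of \<rat> "\<lambda>n q. (1 / c q) *\<^sub>R z n q" 1])
    show "countable (\<rat> :: real set)" by (rule countable_rat)
  qed (rule bound, rule that)
  have "convergent (\<lambda>n. z (k n) q)" if q: "q \<in> \<rat>" for q
  proof -
    from k(2)[OF q] obtain l where "(\<lambda>n. (1 / c q) *\<^sub>R z (k n) q) \<longlonglongrightarrow> l" ..
    then have "(\<lambda>n. c q *\<^sub>R ((1 / c q) *\<^sub>R z (k n) q)) \<longlonglongrightarrow> c q *\<^sub>R l"
      by (intro tendsto_intros)
    then show ?thesis using c[of q] by (auto simp: convergent_def)
  qed
  then have "convergent (\<lambda>n. z (k n) t)" for t
    by (rule convergent_on_dense_lipschitz[OF lip])
  then show ?thesis using that[OF k(1), of "\<lambda>t. lim (\<lambda>n. z (k n) t)"] by (simp add: convergent_LIMSEQ_iff)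
qed

text \<open>
  Tonelli's device: integrating only up to \<open>t - h\<close> makes the integral equation explicit, so that
  Picard iteration is stationary on each bounded interval.
\<close>

lemma delayed_approximation:
  fixes G :: "real \<Rightarrow> 'a::euclidean_space \<Rightarrow> 'a ^ 'n::finite \<Rightarrow> 'a"
  assumes G: "continuous_on ({a..} \<times> UNIV \<times> UNIV) (\<lambda>(t, u, v). G t u v)"
    and \<sigma>: "\<And>i. continuous_on ({a..} \<times> UNIV) (\<lambda>(t, u). \<sigma> i t u)"
    and nonneg: "\<And>i t u. a \<le> t \<Longrightarrow> 0 \<le> \<sigma> i t u"
    and M: "\<And>t u v. a \<le> t \<Longrightarrow> norm (G t u v) \<le> M"
    and \<psi>: "continuous_on {..a} \<psi>" and "0 < h"
  obtains w z where "\<And>t. w t = \<psi> (min t a) + z t" "M-lipschitz_on UNIV z" "\<And>t. t \<le> a \<Longrightarrow> z t = 0"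
    "continuous_on {a..} (delay_rhs G \<sigma> w)"
    "\<And>t. t \<le> a + N \<Longrightarrow> z t = integral {a..t - h} (delay_rhs G \<sigma> w)"
proof -
  define W where "W = rec_nat (\<lambda>t. \<psi> (min t a)) (\<lambda>_ w t. \<psi> (min t a) + integral {a..t - h} (delay_rhs G \<sigma> w))"
  have W0: "W 0 t = \<psi> (min t a)" and WSuc: "W (Suc m) t = \<psi> (min t a) + integral {a..t - h} (delay_rhs G \<sigma> (W m))" for m t
    by (simp_all add: W_def)
  have cont\<psi>: "continuous_on UNIV (\<lambda>t. \<psi> (min t a))"
    by (rule continuous_on_compose2[OF \<psi>]) (auto intro!: continuous_intros)
  have cont_rhs: "continuous_on {a..} (delay_rhs G \<sigma> w)" if "continuous_on UNIV w" for w
    using G \<sigma> that by (rule continuous_on_delay_rhs) auto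
  have bound: "norm (delay_rhs G \<sigma> w t) \<le> M" if "a \<le> t" for w t
    unfolding delay_rhs_def using M[OF that] .
  have lip: "M-lipschitz_on UNIV (\<lambda>t. integral {a..t - h} (delay_rhs G \<sigma> w))" if "continuous_on UNIV w" for w
    using indefinite_integral_lipschitz[OF cont_rhs[OF that] bound]
    by (auto simp: lipschitz_on_def dist_real_def) (smt (verit, best))
  have cont: "continuous_on UNIV (W m)" for m
  proof (induction m)
    case 0
    then show ?case using cont\<psi> by (simp add: W0[abs_def])
  next
    case (Suc m)
    then show ?case unfolding WSuc[abs_def]
      by (intro continuous_intros cont\<psi> lipschitz_on_continuous_on[OF lip])
  qed
  \<comment> \<open>The integral reads the previous iterate only up to \<open>t - h\<close>, and
    nonnegative delays only look further back. Each iteration thus extends the range of agreement by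
    \<open>h\<close>.\<close>
  have step: "W (Suc m) t = W m t" if "t \<le> a + real m * h" for m t
    using that
  proof (induction m arbitrary: t)
    case 0
    then show ?case using \<open>0 < h\<close> by (simp add: WSuc W0)
  next
    case (Suc m)
    have "delay_rhs G \<sigma> (W (Suc m)) s = delay_rhs G \<sigma> (W m) s" if "s \<in> {a..t - h}" for s
    proof (rule delay_rhs_cong)
      have "s \<le> a + real m * h" "a \<le> s" using Suc.prems that by (auto simp: algebra_simps)
      then show "W (Suc m) s = W m s" "W (Suc m) (s - \<sigma> i s (W m s)) = W m (s - \<sigma> i s (W m s))" for i
        using nonneg[of s i "W m s"] by (auto intro!: Suc.IH)
    qed
    then show ?case unfolding WSuc[of "Suc m"] WSuc[of m]
      by (intro arg_cong2[where f = "(+)"] Henstock_Kurzweil_Integration.integral_cong) auto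
  qed
  \<comment> \<open>By \<open>step\<close>, \<open>W m\<close> is a fixed point of the iteration up to time \<open>a + m h\<close>.\<close>
  obtain m where m: "N < real m * h" using ex_less_of_nat_mult[OF \<open>0 < h\<close>] by blast
  show thesis
  proof (rule that[of "W (Suc m)" "\<lambda>t. W (Suc m) t - \<psi> (min t a)"])
    show "W (Suc m) t - \<psi> (min t a) = integral {a..t - h} (delay_rhs G \<sigma> (W (Suc m)))" if "t \<le> a + N" for t
      using step[of t "Suc m"] WSuc[of "Suc m" t] that m \<open>0 < h\<close> by (auto simp: algebra_simps)
    show "M-lipschitz_on UNIV (\<lambda>t. W (Suc m) t - \<psi> (min t a))"
      using lip[OF cont, of m] by (simp add: WSuc)
    show "W (Suc m) t - \<psi> (min t a) = 0" if "t \<le> a" for t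
      using that \<open>0 < h\<close> by (simp add: WSuc)
  qed (auto intro: cont_rhs cont)
qed

lemma has_vector_derivative_indefinite_integral:
  fixes F :: "real \<Rightarrow> 'a::banach"
  assumes "continuous_on {a..} F" "a \<le> t"
  shows "((\<lambda>t. integral {a..t} F) has_vector_derivative F t) (at t within {a..})"
proof -
  have "continuous_on {a..t + 1} F" using assms(1) by (rule continuous_on_subset) auto
  then have "((\<lambda>t. integral {a..t} F) has_vector_derivative F t) (at t within {a..t + 1})"
    using assms(2) by (intro integral_has_vector_derivative) auto
  moreover have "at t within {a..t + 1} = at t within {a..}"
    by (rule at_within_nhd[of t "{..<t + 1}"]) auto
  ultimately show ?thesis by simp
qed

text \<open>The bound \<open>M\<close> is a common Lipschitz constant for the approximations, so a
  subsequence converges; dominated convergence then passes to the limit in the integral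
  equation.\<close>

theorem delay_peano:
  fixes G :: "real \<Rightarrow> 'a::euclidean_space \<Rightarrow> 'a ^ 'n::finite \<Rightarrow> 'a"
  assumes G: "continuous_on ({a..} \<times> UNIV \<times> UNIV) (\<lambda>(t, u, v). G t u v)"
    and \<sigma>: "\<And>i. continuous_on ({a..} \<times> UNIV) (\<lambda>(t, u). \<sigma> i t u)"
    and nonneg: "\<And>i t u. a \<le> t \<Longrightarrow> 0 \<le> \<sigma> i t u"
    and M: "\<And>t u v. a \<le> t \<Longrightarrow> norm (G t u v) \<le> M"
    and \<psi>: "continuous_on {..a} \<psi>"
  obtains w where "continuous_on UNIV w" "\<And>t. t \<le> a \<Longrightarrow> w t = \<psi> t"
    "\<And>t. a \<le> t \<Longrightarrow> (w has_vector_derivative delay_rhs G \<sigma> w t) (at t within {a..})"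
proof -
  define h where "h n = 1 / real (Suc n)" for n
  have "0 < h n" for n by (simp add: h_def)
  define P where "P n w z \<longleftrightarrow> (\<forall>t. w t = \<psi> (min t a) + z t) \<and> M-lipschitz_on UNIV z \<and> (\<forall>t\<le>a. z t = 0) \<and>
      continuous_on {a..} (delay_rhs G \<sigma> w) \<and> (\<forall>t\<le>a + real n. z t = integral {a..t - h n} (delay_rhs G \<sigma> w))"
    for n w and z :: "real \<Rightarrow> 'a"
  \<comment> \<open>The horizon \<open>a + n\<close> grows while the lag \<open>h n\<close> shrinks,
    so each fixed time is eventually covered.\<close>
  have "\<exists>w z. P n w z" for n
    unfolding P_def
    by (rule delayed_approximation[where \<sigma> = \<sigma> and N = "real n", OF G \<sigma> nonneg M \<psi> \<open>0 < h n\<close>]) blast+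
  then obtain w z where "\<And>n. P n (w n) (z n)" by metis
  then have w: "\<And>n t. w n t = \<psi> (min t a) + z n t" and lip: "\<And>n. M-lipschitz_on UNIV (z n)"
    and z0: "\<And>n t. t \<le> a \<Longrightarrow> z n t = 0" and cont: "\<And>n. continuous_on {a..} (delay_rhs G \<sigma> (w n))"
    and z: "\<And>n t. t \<le> a + real n \<Longrightarrow> z n t = integral {a..t - h n} (delay_rhs G \<sigma> (w n))"
    unfolding P_def by blast+
  obtain k Z where k: "strict_mono (k :: nat \<Rightarrow> nat)" and lim: "\<And>t. (\<lambda>n. z (k n) t) \<longlonglongrightarrow> Z t"
    by (rule equilipschitz_convergent_subsequence[where z = z, OF lip z0[OF order_refl]]) blast
  define u where "u t = \<psi> (min t a) + Z t" for t
  have "0 \<le> M" using lip by (rule lipschitz_on_nonneg)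
  have "M-lipschitz_on UNIV Z"
  proof (rule lipschitz_onI[OF _ \<open>0 \<le> M\<close>])
    show "dist (Z x) (Z y) \<le> M * dist x y" for x y
      by (rule LIMSEQ_le_const2[OF tendsto_dist[OF lim[of x] lim[of y]]]) (auto intro: lipschitz_onD[OF lip])
  qed
  have cont\<psi>: "continuous_on UNIV (\<lambda>t. \<psi> (min t a))"
    by (rule continuous_on_compose2[OF \<psi>]) (auto intro!: continuous_intros)
  have cont_u: "continuous_on UNIV u"
    unfolding u_def[abs_def]
    by (intro continuous_intros cont\<psi> lipschitz_on_continuous_on[OF \<open>M-lipschitz_on UNIV Z\<close>])
  have cont_rhs: "continuous_on {a..} (delay_rhs G \<sigma> u)"
    using G \<sigma> cont_u by (rule continuous_on_delay_rhs) auto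
  have bound: "norm (delay_rhs G \<sigma> w t) \<le> M" if "a \<le> t" for w t
    unfolding delay_rhs_def using M[OF that] .
  \<comment> \<open>Because the delays depend on the state, the delayed times vary with
    \<open>n\<close>; convergence is needed along moving arguments.\<close>
  have lim_w: "(\<lambda>n. w (k n) (b n)) \<longlonglongrightarrow> u c" if "b \<longlonglongrightarrow> c" for b c
  proof -
    have "(\<lambda>n. z (k n) (b n) - z (k n) c) \<longlonglongrightarrow> 0"
    proof (rule Lim_null_comparison)
      show "\<forall>\<^sub>F n in sequentially. norm (z (k n) (b n) - z (k n) c) \<le> M * \<bar>b n - c\<bar>"
        using lipschitz_onD[OF lip, of "b _" c] by (auto simp: dist_norm)
      have "(\<lambda>n. M * \<bar>b n - c\<bar>) \<longlonglongrightarrow> M * \<bar>c - c\<bar>" by (intro tendsto_intros that)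
      then show "(\<lambda>n. M * \<bar>b n - c\<bar>) \<longlonglongrightarrow> 0" by simp
    qed
    from tendsto_add[OF this lim[of c]] have "(\<lambda>n. z (k n) (b n)) \<longlonglongrightarrow> Z c" by simp
    moreover have "(\<lambda>n. \<psi> (min (b n) a)) \<longlonglongrightarrow> \<psi> (min c a)"
      using continuous_on_tendsto_compose[OF cont\<psi> that] by simp
    ultimately show ?thesis unfolding w u_def by (intro tendsto_add)
  qed
  have lim_rhs: "(\<lambda>n. delay_rhs G \<sigma> (w (k n)) s) \<longlonglongrightarrow> delay_rhs G \<sigma> u s" if "a \<le> s" for s
  proof -
    have "(\<lambda>n. (s, w (k n) s)) \<longlonglongrightarrow> (s, u s)" by (intro tendsto_intros lim_w)
    from continuous_on_tendsto_compose[OF \<sigma> this] that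
    have "(\<lambda>n. \<sigma> i s (w (k n) s)) \<longlonglongrightarrow> \<sigma> i s (u s)" for i by simp
    then have "(\<lambda>n. (s, w (k n) s, \<chi> i. w (k n) (s - \<sigma> i s (w (k n) s)))) \<longlonglongrightarrow> (s, u s, \<chi> i. u (s - \<sigma> i s (u s)))"
      by (intro tendsto_intros lim_w)
    from continuous_on_tendsto_compose[OF G this] that show ?thesis by (simp add: delay_rhs_def)
  qed
  have u: "u t = \<psi> a + integral {a..t} (delay_rhs G \<sigma> u)" if "a \<le> t" for t
  proof -
    define I where "I n t = integral {a..t} (delay_rhs G \<sigma> (w (k n)))" for n t
    have 1: "(\<lambda>n. I n t) \<longlonglongrightarrow> integral {a..t} (delay_rhs G \<sigma> u)"
      unfolding I_def
    proof (rule dominated_convergence(2))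
      show "delay_rhs G \<sigma> (w (k n)) integrable_on {a..t}" for n
        by (intro integrable_continuous_real continuous_on_subset[OF cont]) auto
      show "(\<lambda>t. M) integrable_on {a..t}" by (rule integrable_const_ivl)
    qed (use bound lim_rhs in auto)
    \<comment> \<open>Stopping the integral \<open>h\<close> too early costs at most
      \<open>M * h\<close>.\<close>
    have 2: "(\<lambda>n. z (k n) t - I n t) \<longlonglongrightarrow> 0"
    proof (rule Lim_null_comparison)
      have "norm (z (k n) t - I n t) \<le> M * h (k n)" if "n \<ge> nat \<lceil>t - a\<rceil>" for n
      proof -
        have "n \<le> k n" using k by (rule seq_suble)
        then have "t \<le> a + real (k n)" using that by linarith
        then have "z (k n) t = I n (t - h (k n))" using z by (simp add: I_def)
        then show ?thesis
          using lipschitz_onD[OF indefinite_integral_lipschitz[OF cont bound], of "t - h (k n)" t "k n"] \<open>0 < h (k n)\<close>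
          by (simp add: I_def dist_norm)
      qed
      then show "\<forall>\<^sub>F n in sequentially. norm (z (k n) t - I n t) \<le> M * h (k n)"
        by (rule eventually_sequentiallyI)
      have "h \<longlonglongrightarrow> 0" unfolding h_def[abs_def] using LIMSEQ_inverse_real_of_nat by (simp add: inverse_eq_divide)
      then have "(\<lambda>n. h (k n)) \<longlonglongrightarrow> 0" using LIMSEQ_subseq_LIMSEQ[OF _ k] by (simp add: o_def)
      then show "(\<lambda>n. M * h (k n)) \<longlonglongrightarrow> 0" by (rule tendsto_mult_right_zero)
    qed
    have "Z t = integral {a..t} (delay_rhs G \<sigma> u)"
      using tendsto_add[OF 2 1] lim[of t] by (intro LIMSEQ_unique) auto
    then show ?thesis using that by (simp add: u_def)
  qed
  show thesis
  proof (rule that[OF cont_u])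
    show "u t = \<psi> t" if "t \<le> a" for t
    proof -
      have "Z t = 0" using lim[of t] z0[OF that] by (simp add: LIMSEQ_const_iff)
      then show ?thesis using that by (simp add: u_def)
    qed
    show "(u has_vector_derivative delay_rhs G \<sigma> u t) (at t within {a..})" if "a \<le> t" for t
    proof -
      have "((\<lambda>t. \<psi> a + integral {a..t} (delay_rhs G \<sigma> u)) has_vector_derivative 0 + delay_rhs G \<sigma> u t) (at t within {a..})"
        by (intro has_vector_derivative_add has_vector_derivative_const has_vector_derivative_indefinite_integral cont_rhs that)
      then have "((\<lambda>t. \<psi> a + integral {a..t} (delay_rhs G \<sigma> u)) has_vector_derivative delay_rhs G \<sigma> u t) (at t within {a..})"
        by simp
      then show ?thesis by (rule has_vector_derivative_transform[rotated 2]) (use u that in auto)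
    qed
  qed
qed

section \<open>A priori bounds\<close>

locale dde =
  fixes f :: "real \<Rightarrow> real ^ 'd \<Rightarrow> (real ^ 'd) ^ 'n \<Rightarrow> real ^ 'd"
    and \<tau> :: "'n::finite \<Rightarrow> real \<Rightarrow> real ^ 'd \<Rightarrow> real"
    and t0 \<delta>0 L0 L :: real
    and Lv L\<tau> :: "'n \<Rightarrow> real"
  assumes cont_f: "continuous_on ({t0..} \<times> UNIV \<times> UNIV) (\<lambda>(t, u, v). f t u v)"
    and cont_tau: "\<And>i. continuous_on ({t0..} \<times> UNIV) (\<lambda>(t, u). \<tau> i t u)"
    and zero: "\<And>t. t \<ge> t0 \<Longrightarrow> f t 0 0 = 0"
    and tau_max: "0 < tau_max \<tau> t0" "tau_max \<tau> t0 < \<infinity>"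
    and pos: "\<delta>0 > 0" "L0 > 0" "\<And>i. Lv i > 0"
    and lip_f: "\<And>t u u' v v'. t \<ge> t0 \<Longrightarrow> u \<in> cball 0 \<delta>0 \<Longrightarrow> u' \<in> cball 0 \<delta>0 \<Longrightarrow>
        (\<And>i. v $ i \<in> cball 0 \<delta>0) \<Longrightarrow> (\<And>i. v' $ i \<in> cball 0 \<delta>0) \<Longrightarrow>
        norm (f t u v - f t u' v') \<le> L0 * norm (u - u') + (\<Sum>i\<in>UNIV. Lv i * norm (v $ i - v' $ i))"
    and L: "L = L0 + (\<Sum>i\<in>UNIV. Lv i)"
    and tau_nonneg: "\<And>i t u. t \<ge> t0 \<Longrightarrow> u \<in> cball 0 \<delta>0 \<Longrightarrow> \<tau> i t u \<ge> 0"
    and lip_tau: "\<And>i t. t \<ge> t0 \<Longrightarrow> (L\<tau> i)-lipschitz_on (cball 0 \<delta>0) (\<tau> i t)"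
begin

abbreviation "r \<equiv> delay_sup \<tau> t0"

lemma L_pos: "0 < L"
  using pos(2) sum_nonneg[of UNIV Lv] pos(3) by (simp add: L add_pos_nonneg less_imp_le)

lemma L\<tau>_nonneg: "0 \<le> L\<tau> i"
  using lip_tau[of t0 i] lipschitz_on_nonneg by blast

text \<open>A single Lipschitz constant valid for all delays at once.\<close>

definition K where "K = (\<Sum>i\<in>UNIV. L\<tau> i)"

lemma L\<tau>_le_K: "L\<tau> i \<le> K"
  unfolding K_def using L\<tau>_nonneg by (intro member_le_sum) auto

lemma K_nonneg: "0 \<le> K"
  unfolding K_def using L\<tau>_nonneg by (intro sum_nonneg) auto

lemma tau_lipschitz:
  assumes "t \<ge> t0" "norm u \<le> \<delta>0" "norm u' \<le> \<delta>0"
  shows "\<tau> i t u \<le> \<tau> i t u' + K * norm (u - u')"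
proof -
  have "\<bar>\<tau> i t u - \<tau> i t u'\<bar> \<le> L\<tau> i * norm (u - u')"
    using lipschitz_onD[OF lip_tau[OF assms(1)], of u u'] assms by (simp add: dist_norm)
  also have "\<dots> \<le> K * norm (u - u')" using L\<tau>_le_K by (intro mult_right_mono) auto
  finally show ?thesis by linarith
qed

text \<open>\<open>delay_sup\<close> is a supremum of reals and says something only for a set
  bounded above. Finiteness of \<open>tau_max\<close> bounds the delays at \<open>u = 0\<close>, and
  the Lipschitz condition spreads this over the ball.\<close>

lemma tau_bounded: obtains B where "\<And>i t u. t \<ge> t0 \<Longrightarrow> norm u \<le> \<delta>0 \<Longrightarrow> \<tau> i t u \<le> B"
proof -
  have *: "ereal (\<tau> i t 0) \<le> tau_max \<tau> t0" if "t \<ge> t0" for i t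
  proof -
    have "ereal (\<tau> i t 0) \<le> (SUP t\<in>{t0..}. ereal (\<tau> i t 0))" using that by (intro SUP_upper) auto
    also have "\<dots> \<le> tau_max \<tau> t0" unfolding tau_max_def by (intro Max_ge) auto
    finally show ?thesis .
  qed
  obtain b where b: "tau_max \<tau> t0 = ereal b" using tau_max by (cases "tau_max \<tau> t0") auto
  show thesis
  proof (rule that[of "b + K * \<delta>0"])
    fix i t and u :: "real ^ 'd" assume "t \<ge> t0" "norm u \<le> \<delta>0"
    have "\<tau> i t u \<le> \<tau> i t 0 + K * norm u"
      using tau_lipschitz[OF \<open>t \<ge> t0\<close> \<open>norm u \<le> \<delta>0\<close>, of 0 i] pos(1) by simp
    also have "\<dots> \<le> b + K * \<delta>0"
      using *[OF \<open>t \<ge> t0\<close>, of i] b \<open>norm u \<le> \<delta>0\<close> K_nonneg by (intro add_mono mult_left_mono) auto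
    finally show "\<tau> i t u \<le> b + K * \<delta>0" .
  qed
qed

lemma tau_le_r:
  assumes "t \<ge> t0" "norm u \<le> \<delta>" "\<delta> \<le> \<delta>0"
  shows "\<tau> i t u \<le> r \<delta>"
proof -
  obtain B where "\<And>i t u. t \<ge> t0 \<Longrightarrow> norm u \<le> \<delta>0 \<Longrightarrow> \<tau> i t u \<le> B" using tau_bounded by blast
  then have "bdd_above {\<tau> i t u | i t u. t \<ge> t0 \<and> norm u \<le> \<delta>}"
    using assms(3) by (auto intro!: bdd_aboveI[of _ B] dest: order_trans)
  then show ?thesis unfolding delay_sup_def using assms by (intro cSup_upper) auto
qed

lemma r_least:
  assumes "0 \<le> \<delta>" "\<And>i t u. t \<ge> t0 \<Longrightarrow> norm u \<le> \<delta> \<Longrightarrow> \<tau> i t u \<le> c"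
  shows "r \<delta> \<le> c"
  unfolding delay_sup_def
proof (rule cSup_least)
  have "\<tau> undefined t0 0 \<in> {\<tau> i t u | i t u. t \<ge> t0 \<and> norm u \<le> \<delta>}" using assms(1) by force
  then show "{\<tau> i t u | i t u. t \<ge> t0 \<and> norm u \<le> \<delta>} \<noteq> {}" by blast
qed (use assms(2) in auto)

lemma r_nonneg: "0 \<le> \<delta> \<Longrightarrow> \<delta> \<le> \<delta>0 \<Longrightarrow> 0 \<le> r \<delta>"
  using tau_nonneg[of t0 0 undefined] tau_le_r[of t0 0 \<delta> undefined] pos(1) by auto

lemma r_mono: "0 \<le> \<delta> \<Longrightarrow> \<delta> \<le> \<delta>' \<Longrightarrow> \<delta>' \<le> \<delta>0 \<Longrightarrow> r \<delta> \<le> r \<delta>'"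
  by (intro r_least tau_le_r) auto

text \<open>Radial shrinking by \<open>\<delta> / \<delta>'\<close> moves a point of the larger ball
  into the smaller one by at most \<open>\<delta>' - \<delta>\<close>. This is the quantitative
  continuity of \<open>r\<close> behind \<open>radius_slack\<close>.\<close>

lemma r_lipschitz:
  assumes "0 < \<delta>" "\<delta> \<le> \<delta>'" "\<delta>' \<le> \<delta>0"
  shows "r \<delta>' \<le> r \<delta> + K * (\<delta>' - \<delta>)"
proof (rule r_least)
  fix i t and u :: "real ^ 'd" assume "t \<ge> t0" "norm u \<le> \<delta>'"
  define u' where "u' = (\<delta> / \<delta>') *\<^sub>R u"
  have "norm u' = \<delta> / \<delta>' * norm u" using assms by (simp add: u'_def)
  also have "\<dots> \<le> \<delta> / \<delta>' * \<delta>'" using assms \<open>norm u \<le> \<delta>'\<close> by (intro mult_left_mono) auto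
  finally have "norm u' \<le> \<delta>" using assms by simp
  have "norm (u - u') = norm ((1 - \<delta> / \<delta>') *\<^sub>R u)" by (simp add: u'_def scaleR_left_diff_distrib)
  also have "\<dots> = (1 - \<delta> / \<delta>') * norm u" using assms by simp
  also have "\<dots> \<le> (1 - \<delta> / \<delta>') * \<delta>'" using assms \<open>norm u \<le> \<delta>'\<close> by (intro mult_left_mono) auto
  also have "\<dots> = \<delta>' - \<delta>" using assms by (simp add: field_simps)
  finally have "norm (u - u') \<le> \<delta>' - \<delta>" .
  have "\<tau> i t u \<le> \<tau> i t u' + K * norm (u - u')"
    using \<open>t \<ge> t0\<close> \<open>norm u \<le> \<delta>'\<close> \<open>norm u' \<le> \<delta>\<close> assms by (intro tau_lipschitz) auto
  also have "\<dots> \<le> r \<delta> + K * (\<delta>' - \<delta>)"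
    using \<open>t \<ge> t0\<close> \<open>norm u' \<le> \<delta>\<close> assms \<open>norm (u - u') \<le> \<delta>' - \<delta>\<close> K_nonneg
    by (intro add_mono mult_left_mono tau_le_r) auto
  finally show "\<tau> i t u \<le> r \<delta> + K * (\<delta>' - \<delta>)" .
qed (use assms in auto)

lemma f_bound:
  assumes "t \<ge> t0" "norm u \<le> \<rho>" "\<And>i. norm (v $ i) \<le> \<rho>" "\<rho> \<le> \<delta>0"
  shows "norm (f t u v) \<le> L * \<rho>"
proof -
  have "norm (f t u v - f t 0 0) \<le> L0 * norm (u - 0) + (\<Sum>i\<in>UNIV. Lv i * norm (v $ i - 0 $ i))"
    using assms order_trans[OF assms(2,4)] order_trans[OF assms(3,4)] pos(1) by (intro lip_f) auto
  also have "\<dots> \<le> L0 * \<rho> + (\<Sum>i\<in>UNIV. Lv i * \<rho>)"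
    using assms pos by (intro add_mono sum_mono mult_left_mono) (auto simp: less_imp_le)
  finally show ?thesis by (simp add: zero[OF assms(1)] L distrib_right sum_distrib_right)
qed

lemma delay_rhs_bound:
  assumes "t \<ge> t0" "0 \<le> \<rho>" "\<rho> \<le> \<delta>0" "norm (u t) \<le> \<rho>" "\<And>s. s \<in> {t - r \<rho>..t} \<Longrightarrow> norm (u s) \<le> \<rho>"
  shows "norm (delay_rhs f \<tau> u t) \<le> L * \<rho>"
  unfolding delay_rhs_def
proof (rule f_bound)
  show "norm ((\<chi> i. u (t - \<tau> i t (u t))) $ i) \<le> \<rho>" for i
    using assms tau_le_r[of t "u t" \<rho> i] tau_nonneg[of t "u t" i] by auto
qed (use assms in auto)

lemma solution_gt: "dde_solution f \<tau> t0 \<delta>0 \<phi> tf u \<Longrightarrow> ereal t0 < tf"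
  and solution_init: "dde_solution f \<tau> t0 \<delta>0 \<phi> tf u \<Longrightarrow> s \<in> {t0 - r \<delta>0..t0} \<Longrightarrow> u s = \<phi> s"
  and solution_deriv: "dde_solution f \<tau> t0 \<delta>0 \<phi> tf u \<Longrightarrow> t0 \<le> t \<Longrightarrow> ereal t < tf \<Longrightarrow>
    (u has_vector_derivative delay_rhs f \<tau> u t) (at t within {t. t0 \<le> t \<and> ereal t < tf})"
  by (auto simp: dde_solution_def delay_rhs_def)

lemma solution_deriv_within:
  assumes "dde_solution f \<tau> t0 \<delta>0 \<phi> tf u" "t \<in> S" "S \<subseteq> {t0..T}" "ereal T < tf"
  shows "(u has_vector_derivative delay_rhs f \<tau> u t) (at t within S)"
proof (rule has_vector_derivative_within_subset)
  show "S \<subseteq> {t. t0 \<le> t \<and> ereal t < tf}"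
    using assms(3,4) by (auto dest!: subsetD) (meson ereal_less_eq(3) order_le_less_trans)
  then show "(u has_vector_derivative delay_rhs f \<tau> u t) (at t within {t. t0 \<le> t \<and> ereal t < tf})"
    using assms(1,2) by (intro solution_deriv) auto
qed

lemma solution_continuous:
  assumes "dde_solution f \<tau> t0 \<delta>0 \<phi> tf u" "\<phi> \<in> init_funs \<tau> t0 \<delta>0" "ereal T < tf"
  shows "continuous_on {t0 - r \<delta>0..T} u"
proof -
  have "continuous_on {t0 - r \<delta>0..t0} \<phi>" using assms(2) by (simp add: init_funs_def)
  then have "continuous_on {t0 - r \<delta>0..t0} u"
    by (rule continuous_on_cong[THEN iffD1, OF refl, rotated]) (simp add: solution_init[OF assms(1)])
  moreover have "continuous_on {t0..T} u"
    by (rule continuous_on_vector_derivative) (rule solution_deriv_within[OF assms(1) _ subset_refl assms(3)])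
  ultimately have "continuous_on ({t0 - r \<delta>0..t0} \<union> {t0..T}) u"
    by (intro continuous_on_closed_Un) auto
  then show ?thesis by (rule continuous_on_subset) auto
qed

text \<open>Compactness of the initial interval turns a strict pointwise bound into a bound with
  room to spare; every later perturbation of constants uses this room.\<close>

lemma init_attained:
  assumes \<phi>: "\<phi> \<in> init_funs \<tau> t0 \<delta>0" and \<delta>: "0 < \<delta>" "\<delta> \<le> \<delta>0"
    and b: "\<And>s. s \<in> {t0 - r \<delta>..t0} \<Longrightarrow> norm (\<phi> s) < b"
  obtains m where "0 \<le> m" "m < b" "\<And>s. s \<in> {t0 - r \<delta>..t0} \<Longrightarrow> norm (\<phi> s) \<le> m"
proof -
  have r: "0 \<le> r \<delta>" "r \<delta> \<le> r \<delta>0" using \<delta> r_nonneg r_mono by auto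
  have "continuous_on {t0 - r \<delta>..t0} \<phi>"
    using \<phi> r unfolding init_funs_def by (auto elim: continuous_on_subset)
  then have "\<exists>p\<in>{t0 - r \<delta>..t0}. \<forall>s\<in>{t0 - r \<delta>..t0}. norm (\<phi> s) \<le> norm (\<phi> p)"
    using r by (intro continuous_attains_sup continuous_on_norm) auto
  then obtain p where "p \<in> {t0 - r \<delta>..t0}" "\<forall>s\<in>{t0 - r \<delta>..t0}. norm (\<phi> s) \<le> norm (\<phi> p)" ..
  then show thesis using b by (intro that[of "norm (\<phi> p)"]) auto
qed

text \<open>The barrier \<open>W\<close> is increasing, so at a first contact the whole relevant
  past is bounded by \<open>W t\<close>. The right-hand side is then at most \<open>L * W t\<close>,
  less than the slope \<open>\<Lambda> * W t\<close>. Squares are compared because the norm is not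
  differentiable at \<open>0\<close>.\<close>

lemma solution_growth:
  assumes sol: "dde_solution f \<tau> t0 \<delta>0 \<phi> tf u" and \<phi>: "\<phi> \<in> init_funs \<tau> t0 \<delta>0"
    and \<delta>: "0 < \<delta>" "\<delta> \<le> \<delta>0" and small: "\<And>s. s \<in> {t0 - r \<delta>..t0} \<Longrightarrow> norm (\<phi> s) < \<delta> * exp (- L * c)"
    and T: "t0 \<le> T" "T \<le> t0 + c" "ereal T < tf"
  shows "norm (u T) < \<delta>"
proof -
  have r: "0 \<le> r \<delta>" "r \<delta> \<le> r \<delta>0" using \<delta> r_nonneg r_mono by auto
  have init: "u s = \<phi> s" if "s \<in> {t0 - r \<delta>..t0}" for s using solution_init[OF sol, of s] r that by auto
  obtain m0 where m0: "0 \<le> m0" "m0 < \<delta> * exp (- L * c)" "\<And>s. s \<in> {t0 - r \<delta>..t0} \<Longrightarrow> norm (\<phi> s) \<le> m0"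
    using init_attained[OF \<phi> \<delta> small] by blast
  \<comment> \<open>The room below \<open>\<delta> * exp (- L * c)\<close> is spent on a rate
    \<open>\<Lambda>\<close> slightly above \<open>L\<close> and on a starting height
    \<open>m\<close> slightly above the initial data.\<close>
  have "((\<lambda>\<Lambda>. \<delta> * exp (- \<Lambda> * c)) \<longlongrightarrow> \<delta> * exp (- L * c)) (at_right L)"
    by (intro tendsto_intros)
  then have "\<forall>\<^sub>F \<Lambda> in at_right L. m0 < \<delta> * exp (- \<Lambda> * c)"
    using m0(2) by (rule order_tendstoD)
  moreover have "\<forall>\<^sub>F \<Lambda> in at_right L. L < \<Lambda>" by (rule eventually_at_right_less)
  ultimately have "\<forall>\<^sub>F \<Lambda> in at_right L. m0 < \<delta> * exp (- \<Lambda> * c) \<and> L < \<Lambda>" by (rule eventually_conj)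
  then obtain \<Lambda> where \<Lambda>: "m0 < \<delta> * exp (- \<Lambda> * c)" "L < \<Lambda>"
    using eventually_happens by (metis (no_types, lifting) trivial_limit_at_right_real)
  obtain m where m: "m0 < m" "m < \<delta> * exp (- \<Lambda> * c)" using dense[OF \<Lambda>(1)] by blast
  have "0 < m" using m(1) m0(1) by linarith
  have "0 < \<Lambda>" using \<Lambda>(2) L_pos by simp
  define W where "W t = m * exp (\<Lambda> * (t - t0))" for t
  have W_mono: "W s \<le> W t" if "s \<le> t" for s t using \<open>0 < m\<close> \<open>0 < \<Lambda>\<close> that by (simp add: W_def)
  have W_pos: "0 < W t" for t using \<open>0 < m\<close> by (simp add: W_def)
  have "W T \<le> m * exp (\<Lambda> * c)" using \<open>0 < m\<close> \<open>0 < \<Lambda>\<close> T by (simp add: W_def)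
  also have "\<dots> < \<delta> * exp (- \<Lambda> * c) * exp (\<Lambda> * c)" using m(2) by simp
  also have "\<dots> = \<delta>" by (simp add: mult.assoc flip: exp_add)
  finally have "W T < \<delta>" .
  have before: "norm (u s) < W t0" if "s \<in> {t0 - r \<delta>..t0}" for s
    using m0(3)[OF that] m(1) init[OF that] by (simp add: W_def)
  have "(norm (u T))\<^sup>2 < (W T)\<^sup>2"
  proof (rule strict_barrier[OF T(1)])
    show "(norm (u t0))\<^sup>2 < (W t0)\<^sup>2" using before[of t0] r by (intro power_strict_mono) auto
    show "((\<lambda>t. (norm (u t))\<^sup>2) has_real_derivative 2 * (u t \<bullet> delay_rhs f \<tau> u t)) (at t within {t0..T})"
      if "t0 \<le> t" "t \<le> T" for t
      using that by (intro has_real_derivative_norm_square solution_deriv_within[OF sol _ subset_refl T(3)]) auto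
    show "((\<lambda>t. (W t)\<^sup>2) has_real_derivative 2 * (W t * (\<Lambda> * W t))) (at t within {t0..T})" for t
      unfolding W_def by (auto intro!: derivative_eq_intros)
    fix t assume t: "t0 < t" "t \<le> T" and less: "\<And>s. t0 \<le> s \<Longrightarrow> s < t \<Longrightarrow> (norm (u s))\<^sup>2 < (W s)\<^sup>2"
      and "(norm (u t))\<^sup>2 = (W t)\<^sup>2"
    then have eq: "norm (u t) = W t" using W_pos[of t] by (simp add: power2_eq_iff_nonneg)
    have "W t < \<delta>" using W_mono[OF t(2)] \<open>W T < \<delta>\<close> by simp
    then have "r (W t) \<le> r \<delta>" using W_pos[of t] \<delta> by (intro r_mono) auto
    have "norm (u s) \<le> W t" if s: "s \<in> {t - r (W t)..t}" for s
    proof -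
      consider "s < t0" | "t0 \<le> s" "s < t" | "s = t" using s by force
      then show ?thesis
      proof cases
        case 1
        then show ?thesis using before[of s] W_mono[of t0 t] s t \<open>r (W t) \<le> r \<delta>\<close> by auto
      next
        case 2
        then have "norm (u s) < W s" using less[of s] W_pos[of s] by (auto intro: power2_less_imp_less)
        then show ?thesis using W_mono[of s t] 2 by simp
      qed (use eq in simp)
    qed
    then have "norm (delay_rhs f \<tau> u t) \<le> L * W t"
      using t \<open>W t < \<delta>\<close> W_pos[of t] eq \<delta> by (intro delay_rhs_bound) auto
    then have "u t \<bullet> delay_rhs f \<tau> u t \<le> W t * (L * W t)"
      using norm_cauchy_schwarz[of "u t" "delay_rhs f \<tau> u t"] eq W_pos[of t]
      by (smt (verit, best) mult_left_mono)
    also have "\<dots> < W t * (\<Lambda> * W t)" using W_pos[of t] \<Lambda>(2) by simp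
    finally show "2 * (u t \<bullet> delay_rhs f \<tau> u t) < 2 * (W t * (\<Lambda> * W t))" by simp
  qed
  then have "norm (u T) < W T" using W_pos[of T] by (auto intro: power2_less_imp_less)
  then show ?thesis using \<open>W T < \<delta>\<close> by simp
qed

end

section \<open>Regularity of solutions and the bound from the auxiliary ODE\<close>

locale dde_razumikhin = dde f \<tau> t0 \<delta>0 L0 L Lv L\<tau>
  for f :: "real \<Rightarrow> real ^ 'd \<Rightarrow> (real ^ 'd) ^ 'n \<Rightarrow> real ^ 'd"
    and \<tau> :: "'n::finite \<Rightarrow> real \<Rightarrow> real ^ 'd \<Rightarrow> real"
    and t0 \<delta>0 L0 L :: real and Lv L\<tau> :: "'n \<Rightarrow> real" +
  fixes k :: nat and \<delta>1 :: real
  assumes k: "k \<ge> 1"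
    and smooth: "dde_smooth f \<tau> t0 k"
    and delta1: "\<delta>1 \<in> {0<..\<delta>0}"
    and razumikhin: "\<And>\<delta> x ts \<eta>. \<delta> \<in> {0<..<\<delta>1} \<Longrightarrow> norm x = \<delta> \<Longrightarrow>
        ts \<ge> t0 + real k * delay_sup \<tau> t0 \<delta> \<Longrightarrow> \<eta> \<in> E_set f \<tau> t0 \<delta>0 k \<delta> x ts \<Longrightarrow>
        \<exists>I v. aux_solution f \<tau> x ts \<eta> I v \<and> \<tau> I ts x > 0 \<and>
          (1 / \<delta> * (v 0 \<bullet> x) < \<delta> \<or>
           1 / \<delta> * (v 0 \<bullet> x) = \<delta> \<and>
             vector_derivative v (at 0 within {- \<tau> I ts x..0}) \<bullet> x \<le> 0)"
begin

text \<open>A delay reaches back by at most \<open>r \<delta>\<close>, so the left end moves right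
  by one period to stay where \<open>u\<close> is of class \<open>Ck_on j\<close>. For
  \<open>j = 0\<close> that earlier domain includes the initial interval
  \<open>[t0 - r \<delta>, t0]\<close>.\<close>

lemma delayed_smooth:
  assumes u: "Ck_on j {t0 + (real j - 1) * r \<delta>..c} u" and "j \<le> k - 1" and \<delta>: "0 < \<delta>" "\<delta> \<le> \<delta>0"
    and le: "\<And>t. t \<in> {t0..c} \<Longrightarrow> norm (u t) \<le> \<delta>"
  shows "Ck_on j {t0 + real j * r \<delta>..c} (\<lambda>t. u (t - \<tau> i t (u t)))"
proof (rule Ck_on_compose[OF u])
  have r: "0 \<le> r \<delta>" using \<delta> by (intro r_nonneg) auto
  then have ge: "t \<ge> t0" if "t \<ge> t0 + real j * r \<delta>" for t
    using that mult_nonneg_nonneg[OF of_nat_0_le_iff r, of j] by linarith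
  have "Ck_on j ({t0..} \<times> UNIV) (\<lambda>(t, u). \<tau> i t u)"
    using smooth \<open>j \<le> k - 1\<close> Ck_on_le unfolding dde_smooth_def by blast
  moreover have "Ck_on j {t0 + real j * r \<delta>..c} (\<lambda>t. (t, u t))"
    using r by (intro Ck_on_Pair Ck_on_ident Ck_on_subset[OF u]) (auto simp: algebra_simps)
  ultimately have "Ck_on j {t0 + real j * r \<delta>..c} (\<lambda>t. (\<lambda>(t, u). \<tau> i t u) (t, u t))"
    by (rule Ck_on_compose) (auto dest: ge)
  then show "Ck_on j {t0 + real j * r \<delta>..c} (\<lambda>t. t - \<tau> i t (u t))"
    by (auto intro: Ck_on_diff Ck_on_ident)
  show "(\<lambda>t. t - \<tau> i t (u t)) ` {t0 + real j * r \<delta>..c} \<subseteq> {t0 + (real j - 1) * r \<delta>..c}"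
  proof safe
    fix t assume t: "t \<in> {t0 + real j * r \<delta>..c}"
    then have "t \<ge> t0" using ge by auto
    then have "norm (u t) \<le> \<delta>" using le[of t] t by auto
    then have "\<tau> i t (u t) \<le> r \<delta>" "0 \<le> \<tau> i t (u t)"
      using \<open>t \<ge> t0\<close> \<delta> by (auto intro: tau_le_r tau_nonneg)
    then show "t - \<tau> i t (u t) \<in> {t0 + (real j - 1) * r \<delta>..c}" using t by (auto simp: algebra_simps)
  qed
qed

text \<open>Method of steps: on each further period the right-hand side has the regularity reached
  so far, and integrating it adds one order. To reach order \<open>j + 1\<close>, \<open>f\<close>
  is used only to order \<open>j\<close>, in accordance with \<open>k - 2\<close> against
  \<open>k - 1\<close>.\<close>

lemma solution_smooth:
  assumes sol: "dde_solution f \<tau> t0 \<delta>0 \<phi> tf u" and \<phi>: "\<phi> \<in> init_funs \<tau> t0 \<delta>0" and c: "ereal c < tf"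
    and \<delta>: "0 < \<delta>" "\<delta> \<le> \<delta>0"
    and le: "\<And>t. t \<in> {t0..c} \<Longrightarrow> norm (u t) \<le> \<delta>"
    and "j \<le> k - 1"
  shows "Ck_on j {t0 + (real j - 1) * r \<delta>..c} u"
  using \<open>j \<le> k - 1\<close>
proof (induction j)
  case 0
  have "r \<delta> \<le> r \<delta>0" using \<delta> by (intro r_mono) auto
  then show ?case using solution_continuous[OF sol \<phi> c] by (auto intro: continuous_on_subset)
next
  case (Suc j)
  have r: "0 \<le> r \<delta>" using \<delta> by (intro r_nonneg) auto
  have ge: "t \<ge> t0" if "t \<ge> t0 + real j * r \<delta>" for t
    using that mult_nonneg_nonneg[OF of_nat_0_le_iff r, of j] by linarith
  let ?D = "{t0 + real j * r \<delta>..c}"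
  have u: "Ck_on j {t0 + (real j - 1) * r \<delta>..c} u" using Suc by simp
  have f: "Ck_on j ({t0..} \<times> UNIV \<times> UNIV) (\<lambda>(t, u, v). f t u v)"
    using smooth Suc.prems unfolding dde_smooth_def by (intro Ck_on_le[of "k - 2" _ _ j]) auto
  have "Ck_on j ?D (\<lambda>t. (t, u t, \<chi> i. u (t - \<tau> i t (u t))))"
  proof (intro Ck_on_Pair Ck_on_ident Ck_on_vec_lambda)
    show "Ck_on j ?D u" using r by (intro Ck_on_subset[OF u]) (auto simp: algebra_simps)
    show "Ck_on j ?D (\<lambda>t. u (t - \<tau> i t (u t)))" for i
      using u Suc.prems \<delta> le by (intro delayed_smooth) auto
  qed
  then have "Ck_on j ?D (\<lambda>t. (\<lambda>(t, u, v). f t u v) (t, u t, \<chi> i. u (t - \<tau> i t (u t))))"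
    by (rule Ck_on_compose[OF f]) (auto dest: ge)
  then have "Ck_on j ?D (delay_rhs f \<tau> u)" by (simp add: delay_rhs_def[abs_def])
  moreover have "(u has_vector_derivative delay_rhs f \<tau> u t) (at t within ?D)" if "t \<in> ?D" for t
    using r by (intro solution_deriv_within[OF sol that _ c]) auto
  ultimately show ?case by (auto intro!: Ck_on_Suc_vector_derivative simp del: Ck_on.simps)
qed

text \<open>Assuming the contrary supplies condition (i) of \<open>E_set\<close>, so the hypothesis
  applies to the segments of \<open>u\<close> and refutes the assumption.\<close>

lemma outward_derivative_nonpos:
  assumes sol: "dde_solution f \<tau> t0 \<delta>0 \<phi> tf u" and \<phi>: "\<phi> \<in> init_funs \<tau> t0 \<delta>0"
    and c: "c \<ge> t0 + real k * r \<delta>" "ereal c < tf"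
    and \<delta>: "\<delta> \<in> {0<..<\<delta>1}" "norm (u c) = \<delta>"
    and le: "\<And>s. s \<in> {t0 - r \<delta>..c} \<Longrightarrow> norm (u s) \<le> \<delta>"
  shows "u c \<bullet> delay_rhs f \<tau> u c \<le> 0"
proof (rule ccontr)
  assume "\<not> u c \<bullet> delay_rhs f \<tau> u c \<le> 0"
  have \<delta>0: "0 < \<delta>" "\<delta> < \<delta>0" "\<delta> \<le> \<delta>0" using \<delta> delta1 by auto
  have r: "0 \<le> r \<delta>" using \<delta>0 by (intro r_nonneg) auto
  have "1 * r \<delta> \<le> real k * r \<delta>" using k r by (intro mult_right_mono) auto
  then have cr: "c \<ge> t0 + r \<delta>" using c(1) by simp
  have le': "norm (u t) \<le> \<delta>" if "t \<in> {t0..c}" for t using le[of t] that r by auto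
  define \<eta> where "\<eta> i \<theta> = u (c + \<theta> - \<tau> i (c + \<theta>) (u (c + \<theta>)))" for i \<theta>
  have \<eta>_le: "norm (\<eta> i \<theta>) \<le> \<delta>" if \<theta>: "\<theta> \<in> {- r \<delta>..0}" for i \<theta>
  proof -
    have "c + \<theta> \<in> {t0..c}" using \<theta> cr by auto
    then have "0 \<le> \<tau> i (c + \<theta>) (u (c + \<theta>))" "\<tau> i (c + \<theta>) (u (c + \<theta>)) \<le> r \<delta>"
      using le'[of "c + \<theta>"] \<delta>0 by (auto intro: tau_le_r tau_nonneg)
    then show ?thesis unfolding \<eta>_def using \<theta> cr by (intro le) auto
  qed
  have rhs: "delay_rhs f \<tau> u (c + \<theta>) = f (c + \<theta>) (u (c + \<theta>)) (\<chi> i. \<eta> i \<theta>)" for \<theta>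
    by (simp add: delay_rhs_def \<eta>_def)
  have "Ck_on (k - 1) {- r \<delta>..0} (\<eta> i)" for i
  proof -
    have u: "Ck_on (k - 1) {t0 + (real (k - 1) - 1) * r \<delta>..c} u"
      by (rule solution_smooth[OF sol \<phi> c(2) \<delta>0(1,3) le']) auto
    have "Ck_on (k - 1) {t0 + real (k - 1) * r \<delta>..c} (\<lambda>t. u (t - \<tau> i t (u t)))"
      by (rule delayed_smooth[OF u _ \<delta>0(1,3) le']) auto
    moreover have "Ck_on (k - 1) {- r \<delta>..0} (\<lambda>\<theta>. c + \<theta>)" by (intro Ck_on_add Ck_on_const Ck_on_ident)
    \<comment> \<open>The delayed function is smooth enough after \<open>k - 1\<close> periods, and
      the segment ending at \<open>c\<close> is one period long: together the \<open>k\<close>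
      periods required of \<open>c\<close>.\<close>
    moreover have "(\<lambda>\<theta>. c + \<theta>) ` {- r \<delta>..0} \<subseteq> {t0 + real (k - 1) * r \<delta>..c}"
      using c(1) k by (auto simp: of_nat_diff algebra_simps)
    ultimately show ?thesis unfolding \<eta>_def[abs_def] by (rule Ck_on_compose)
  qed
  moreover have "u c \<bullet> f c (u c) (\<chi> i. \<eta> i 0) \<ge> 0"
    using \<open>\<not> u c \<bullet> delay_rhs f \<tau> u c \<le> 0\<close> rhs[of 0] by simp
  ultimately have "\<eta> \<in> E_set f \<tau> t0 \<delta>0 k \<delta> (u c) c"
    unfolding E_set_def using \<eta>_le \<phi> sol c(2) by (auto simp: \<eta>_def)
  then obtain I v where v: "aux_solution f \<tau> (u c) c \<eta> I v" and \<tau>_pos: "\<tau> I c (u c) > 0"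
    and alt: "1 / \<delta> * (v 0 \<bullet> u c) < \<delta> \<or> 1 / \<delta> * (v 0 \<bullet> u c) = \<delta> \<and>
             vector_derivative v (at 0 within {- \<tau> I c (u c)..0}) \<bullet> u c \<le> 0"
    using razumikhin[OF \<delta> c(1)] by blast
  define b where "b = \<tau> I c (u c)"
  have "b \<le> r \<delta>" "b > 0" unfolding b_def using cr r \<delta> \<delta>0 \<tau>_pos by (auto intro: tau_le_r)
  have v_deriv: "(v has_vector_derivative f (c + \<theta>) (v \<theta>) (\<chi> j. \<eta> j \<theta>)) (at \<theta> within {- b..0})" if "\<theta> \<in> {- b..0}" for \<theta>
    using v that by (simp add: aux_solution_def b_def)
  \<comment> \<open>Both curves see the same delayed arguments \<open>\<eta>\<close>, hence the
    constant \<open>L0\<close> alone. The room is \<open>\<delta> < \<delta>0\<close>, which follows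
    from \<open>\<delta> < \<delta>1\<close>.\<close>
  have "v 0 = u (c + 0)"
  proof (rule ode_unique_in_ball[where a = "- b" and \<rho> = \<delta> and R = \<delta>0 and K = L0
        and H = "\<lambda>\<theta> p. f (c + \<theta>) p (\<chi> j. \<eta> j \<theta>)" and y = "\<lambda>\<theta>. u (c + \<theta>)"])
    \<comment> \<open>The prescribed initial value \<open>\<eta> I 0\<close> is \<open>u\<close> at
      time \<open>c - \<tau> I c (u c)\<close>, that is, at \<open>c - b\<close>.\<close>
    show "v (- b) = u (c + - b)" using v by (simp add: aux_solution_def b_def \<eta>_def)
    show "((\<lambda>\<theta>. u (c + \<theta>)) has_vector_derivative f (c + \<theta>) (u (c + \<theta>)) (\<chi> j. \<eta> j \<theta>)) (at \<theta> within {- b..0})"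
      if \<theta>: "\<theta> \<in> {- b..0}" for \<theta>
    proof -
      have "((+) c has_vector_derivative 1) (at \<theta> within {- b..0})"
        by (auto intro!: derivative_eq_intros)
      moreover have "(u has_vector_derivative delay_rhs f \<tau> u (c + \<theta>)) (at (c + \<theta>) within (+) c ` {- b..0})"
        using \<theta> cr \<open>b \<le> r \<delta>\<close> by (intro solution_deriv_within[OF sol _ _ c(2)]) auto
      ultimately have "(u \<circ> (+) c has_vector_derivative 1 *\<^sub>R delay_rhs f \<tau> u (c + \<theta>)) (at \<theta> within {- b..0})"
        by (rule vector_diff_chain_within)
      then show ?thesis by (simp add: o_def rhs)
    qed
    show "norm (u (c + \<theta>)) \<le> \<delta>" if "\<theta> \<in> {- b..0}" for \<theta>
      using that cr \<open>b \<le> r \<delta>\<close> by (intro le') auto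
    show "norm (f (c + \<theta>) p (\<chi> j. \<eta> j \<theta>) - f (c + \<theta>) q (\<chi> j. \<eta> j \<theta>)) \<le> L0 * norm (p - q)"
      if "\<theta> \<in> {- b..0}" "norm p \<le> \<delta>0" "norm q \<le> \<delta>0" for \<theta> p q
    proof -
      have "norm (\<eta> j \<theta>) \<le> \<delta>0" for j using \<eta>_le[of \<theta> j] that(1) \<open>b \<le> r \<delta>\<close> \<delta>0 by auto
      then show ?thesis
        using that cr \<open>b \<le> r \<delta>\<close>
          lip_f[of "c + \<theta>" p q "\<chi> j. \<eta> j \<theta>" "\<chi> j. \<eta> j \<theta>"] by auto
    qed
  qed (use v_deriv \<open>b > 0\<close> \<delta>0 pos in auto)
  then have v0: "v 0 = u c" by simp
  then have "1 / \<delta> * (v 0 \<bullet> u c) = \<delta>"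
    using \<delta>(2) \<delta>0 by (simp add: power2_norm_eq_inner[symmetric] power2_eq_square)
  then have "vector_derivative v (at 0 within {- b..0}) \<bullet> u c \<le> 0" using alt by (simp add: b_def)
  moreover have "vector_derivative v (at 0 within {- b..0}) = delay_rhs f \<tau> u c"
    using \<open>b > 0\<close> v_deriv[of 0] rhs[of 0] v0 by (auto intro: vector_derivative_within_closed_interval)
  ultimately show False using \<open>\<not> u c \<bullet> delay_rhs f \<tau> u c \<le> 0\<close> by (simp add: inner_commute)
qed

text \<open>Enlarging the radius harms twice: the exponential factor shrinks and the initial
  interval grows to the left. Both effects are small since \<open>r\<close> varies continuously and
  the smallness is strict on a compact interval. The prefactor stays \<open>\<delta>\<close>, so the
  growth estimate still ends below \<open>\<delta>\<close>.\<close>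

lemma radius_slack:
  assumes \<phi>: "\<phi> \<in> init_funs \<tau> t0 \<delta>0" and \<delta>: "\<delta> \<in> {0<..<\<delta>1}"
    and small: "\<And>s. s \<in> {t0 - r \<delta>..t0} \<Longrightarrow> norm (\<phi> s) < \<delta> * exp (- L * (real k * r \<delta>))"
  obtains \<delta>2 where "\<delta> < \<delta>2" "\<delta>2 < \<delta>1"
    "\<And>s. s \<in> {t0 - r \<delta>2..t0} \<Longrightarrow> norm (\<phi> s) < \<delta> * exp (- L * (real k * r \<delta>2))"
proof -
  have \<delta>0: "0 < \<delta>" "\<delta> < \<delta>0" "\<delta> \<le> \<delta>0" using \<delta> delta1 by auto
  have r: "0 \<le> r \<delta>" "r \<delta> \<le> r \<delta>0" using \<delta>0 r_nonneg r_mono by auto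
  obtain m where m: "0 \<le> m" "m < \<delta> * exp (- L * (real k * r \<delta>))" "\<And>s. s \<in> {t0 - r \<delta>..t0} \<Longrightarrow> norm (\<phi> s) \<le> m"
    using init_attained[OF \<phi> \<delta>0(1,3) small] by blast
  obtain m' where m': "m < m'" "m' < \<delta> * exp (- L * (real k * r \<delta>))" using dense[OF m(2)] by blast
  have "((\<lambda>\<rho>. \<delta> * exp (- L * (real k * \<rho>))) \<longlongrightarrow> \<delta> * exp (- L * (real k * r \<delta>))) (nhds (r \<delta>))"
    by (intro tendsto_intros filterlim_ident)
  then have "\<forall>\<^sub>F \<rho> in nhds (r \<delta>). m' < \<delta> * exp (- L * (real k * \<rho>))"
    using m'(2) by (rule order_tendstoD)
  then obtain e1 where e1: "0 < e1" "\<And>\<rho>. \<bar>\<rho> - r \<delta>\<bar> < e1 \<Longrightarrow> m' < \<delta> * exp (- L * (real k * \<rho>))"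
    by (auto simp: eventually_nhds_metric dist_real_def)
  have "continuous_on {t0 - r \<delta>0..t0} (\<lambda>s. norm (\<phi> s))"
    using \<phi> by (auto simp: init_funs_def intro: continuous_intros)
  moreover have "t0 - r \<delta> \<in> {t0 - r \<delta>0..t0}" using r by auto
  \<comment> \<open>On the added piece left of \<open>t0 - r \<delta>\<close>, continuity of
    \<open>\<phi>\<close> at that point replaces the assumption.\<close>
  ultimately obtain e2 where e2: "0 < e2"
    "\<And>s. s \<in> {t0 - r \<delta>0..t0} \<Longrightarrow> \<bar>s - (t0 - r \<delta>)\<bar> < e2 \<Longrightarrow> \<bar>norm (\<phi> s) - norm (\<phi> (t0 - r \<delta>))\<bar> < m' - m"
    using m'(1) unfolding continuous_on_iff dist_real_def by (metis diff_gt_0_iff_gt)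
  \<comment> \<open>By \<open>r_lipschitz\<close>, \<open>r\<close> then increases by less than both
    \<open>e1\<close> and \<open>e2\<close>; \<open>K + 1\<close> guards against
    \<open>K = 0\<close>, and half the distance keeps \<open>\<delta>2\<close> below
    \<open>\<delta>1\<close>.\<close>
  define \<delta>2 where "\<delta>2 = \<delta> + min ((\<delta>1 - \<delta>) / 2) (min e1 e2 / (2 * (K + 1)))"
  have "\<delta> < \<delta>2" using \<delta> e1(1) e2(1) K_nonneg by (simp add: \<delta>2_def)
  moreover have "\<delta>2 \<le> \<delta> + (\<delta>1 - \<delta>) / 2" unfolding \<delta>2_def by (intro add_left_mono min.cobounded1)
  ultimately have \<delta>2: "\<delta> < \<delta>2" "\<delta>2 < \<delta>1" "\<delta>2 \<le> \<delta>0" using \<delta> delta1 by (auto simp: field_simps)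
  have "r \<delta>2 \<le> r \<delta> + K * (\<delta>2 - \<delta>)" using \<delta>2 \<delta>0 by (intro r_lipschitz) auto
  also have "K * (\<delta>2 - \<delta>) \<le> K * (min e1 e2 / (2 * (K + 1)))"
    using K_nonneg min.cobounded2 unfolding \<delta>2_def by (intro mult_left_mono) (simp_all del: min_less_iff_conj)
  also have "\<dots> = min e1 e2 * (K / (2 * (K + 1)))" by simp
  also have "\<dots> < min e1 e2 * 1"
    using K_nonneg e1(1) e2(1) by (intro mult_strict_left_mono) auto
  finally have r2: "r \<delta>2 < r \<delta> + e1" "r \<delta>2 < r \<delta> + e2" by auto
  have r12: "r \<delta> \<le> r \<delta>2" "r \<delta>2 \<le> r \<delta>0" using \<delta>2 \<delta>0 by (auto intro: r_mono)
  show thesis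
  proof (rule that[OF \<delta>2(1,2)])
    fix s assume s: "s \<in> {t0 - r \<delta>2..t0}"
    have "norm (\<phi> s) < m'"
    proof (cases "s \<ge> t0 - r \<delta>")
      case True
      then show ?thesis using m(3)[of s] m'(1) s by auto
    next
      case False
      then show ?thesis using e2(2)[of s] m(3)[of "t0 - r \<delta>"] r r12 r2 s by auto
    qed
    also have "\<dots> < \<delta> * exp (- L * (real k * r \<delta>2))" using r12 r2 by (intro e1(2)) auto
    finally show "norm (\<phi> s) < \<delta> * exp (- L * (real k * r \<delta>2))" .
  qed
qed

text \<open>The slope of the barrier is fitted to a supposed violation at \<open>T\<close>, so no
  limit of slopes is taken. The bound holds for every solution, on whatever interval it
  exists.\<close>

lemma solution_bounded:
  assumes sol: "dde_solution f \<tau> t0 \<delta>0 \<phi> tf u" and \<phi>: "\<phi> \<in> init_funs \<tau> t0 \<delta>0" and \<delta>: "\<delta> \<in> {0<..<\<delta>1}"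
    and small: "\<And>s. s \<in> {t0 - r \<delta>..t0} \<Longrightarrow> norm (\<phi> s) < \<delta> * exp (- L * (real k * r \<delta>))"
    and T: "t0 \<le> T" "ereal T < tf"
  shows "norm (u T) \<le> \<delta>"
proof (rule ccontr)
  assume "\<not> norm (u T) \<le> \<delta>"
  obtain \<delta>2 where \<delta>2: "\<delta> < \<delta>2" "\<delta>2 < \<delta>1"
    and small2: "\<And>s. s \<in> {t0 - r \<delta>2..t0} \<Longrightarrow> norm (\<phi> s) < \<delta> * exp (- L * (real k * r \<delta>2))"
    using radius_slack[OF \<phi> \<delta> small] by blast
  have \<delta>0: "0 < \<delta>" "\<delta> \<le> \<delta>0" "\<delta>2 \<le> \<delta>0" using \<delta> \<delta>2 delta1 by auto
  have r: "0 \<le> r \<delta>" "r \<delta> \<le> r \<delta>2" "r \<delta>2 \<le> r \<delta>0" using \<delta>0 \<delta>2 by (auto intro: r_nonneg r_mono)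
  \<comment> \<open>By monotonicity of \<open>r\<close> this waiting time serves every contact
    radius up to \<open>\<delta>2\<close>.\<close>
  define a where "a = t0 + real k * r \<delta>2"
  have "t0 \<le> a" using r by (simp add: a_def)
  have early: "norm (u t) < \<delta>" if "t \<in> {t0 - r \<delta>2..a}" "ereal t < tf" for t
  proof (cases "t < t0")
    case True
    then have "norm (\<phi> t) < \<delta> * exp (- L * (real k * r \<delta>2))" using small2[of t] that by auto
    also have "\<dots> \<le> \<delta> * 1" using L_pos \<delta>0 r by (intro mult_left_mono) auto
    finally show ?thesis using solution_init[OF sol, of t] True that r by auto
  next
    case False
    show ?thesis
      by (rule solution_growth[OF sol \<phi> \<delta>0(1,2), of "real k * r \<delta>2"])
        (use small2 r that False in \<open>auto simp: a_def\<close>)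
  qed
  have "a < T" using early[of T] \<open>\<not> norm (u T) \<le> \<delta>\<close> T r by force
  have before_tf: "ereal t < tf" if "t \<le> T" for t
    using that T(2) by (meson ereal_less_eq(3) order_le_less_trans)
  \<comment> \<open>The height of the barrier at \<open>T\<close>: not above \<open>|u T|^2\<close>,
    so that staying below it is absurd, and not above \<open>\<delta>2^2\<close>, so that contact
    radii stay within \<open>\<delta>2\<close>.\<close>
  define m where "m = min ((norm (u T))\<^sup>2) (\<delta>2\<^sup>2)"
  define \<epsilon> where "\<epsilon> = (m - \<delta>\<^sup>2) / (T - a)"
  define w where "w t = \<delta>\<^sup>2 + \<epsilon> * (t - a)" for t
  have "\<delta>\<^sup>2 < m" using \<open>\<not> norm (u T) \<le> \<delta>\<close> \<delta>0 \<delta>2 by (auto simp: m_def intro: power_strict_mono)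
  then have "0 < \<epsilon>" using \<open>a < T\<close> by (simp add: \<epsilon>_def)
  have "w T = m" using \<open>a < T\<close> by (simp add: w_def \<epsilon>_def)
  have w_mono: "w s \<le> w t" if "s \<le> t" for s t using \<open>0 < \<epsilon>\<close> that by (simp add: w_def)
  have "(norm (u T))\<^sup>2 < w T"
  proof (rule strict_barrier[OF less_imp_le[OF \<open>a < T\<close>]])
    show "(norm (u a))\<^sup>2 < w a"
      using early[of a] before_tf[of a] \<open>a < T\<close> \<open>t0 \<le> a\<close> r \<delta>0 by (auto simp: w_def intro!: power_strict_mono)
    show "((\<lambda>t. (norm (u t))\<^sup>2) has_real_derivative 2 * (u t \<bullet> delay_rhs f \<tau> u t)) (at t within {a..T})"
      if "a \<le> t" "t \<le> T" for t
      using that \<open>t0 \<le> a\<close> by (intro has_real_derivative_norm_square solution_deriv_within[OF sol _ _ T(2)]) auto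
    show "(w has_real_derivative \<epsilon>) (at t within {a..T})" for t
      unfolding w_def[abs_def] by (auto intro!: derivative_eq_intros)
    fix c assume c: "a < c" "c \<le> T" and less: "\<And>s. a \<le> s \<Longrightarrow> s < c \<Longrightarrow> (norm (u s))\<^sup>2 < w s"
      and eq: "(norm (u c))\<^sup>2 = w c"
    define \<delta>' where "\<delta>' = norm (u c)"
    have "\<delta>\<^sup>2 < \<delta>'\<^sup>2" using eq c \<open>0 < \<epsilon>\<close> by (simp add: w_def \<delta>'_def)
    then have "\<delta> < \<delta>'" by (rule power2_less_imp_less) (simp add: \<delta>'_def)
    have "\<delta>'\<^sup>2 \<le> \<delta>2\<^sup>2" using eq w_mono[OF c(2)] \<open>w T = m\<close> by (simp add: \<delta>'_def m_def)
    then have "\<delta>' \<le> \<delta>2" by (rule power2_le_imp_le) (use \<delta>0 \<delta>2 in auto)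
    have "r \<delta>' \<le> r \<delta>2" using \<open>\<delta> < \<delta>'\<close> \<open>\<delta>' \<le> \<delta>2\<close> \<delta>0 by (intro r_mono) auto
    have "u c \<bullet> delay_rhs f \<tau> u c \<le> 0"
    proof (rule outward_derivative_nonpos[OF sol \<phi>])
      have "real k * r \<delta>' \<le> real k * r \<delta>2" using \<open>r \<delta>' \<le> r \<delta>2\<close> by (intro mult_left_mono) auto
      then show "c \<ge> t0 + real k * r \<delta>'" using c by (simp add: a_def)
      show "norm (u s) \<le> \<delta>'" if s: "s \<in> {t0 - r \<delta>'..c}" for s
      proof -
        consider "s \<le> a" | "a < s" "s < c" | "s = c" using s by force
        then show ?thesis
        proof cases
          case 1
          then show ?thesis using early[of s] before_tf[of s] s c \<open>r \<delta>' \<le> r \<delta>2\<close> \<open>\<delta> < \<delta>'\<close> by auto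
        next
          case 2
          then have "(norm (u s))\<^sup>2 \<le> \<delta>'\<^sup>2" using less[of s] w_mono[of s c] eq by (simp add: \<delta>'_def)
          then show ?thesis by (rule power2_le_imp_le) (simp add: \<delta>'_def)
        qed (simp add: \<delta>'_def)
      qed
    qed (use \<delta>'_def \<open>\<delta> < \<delta>'\<close> \<open>\<delta>' \<le> \<delta>2\<close> \<delta>2 \<delta>0 before_tf[OF c(2)] in auto)
    then show "2 * (u c \<bullet> delay_rhs f \<tau> u c) < \<epsilon>" using \<open>0 < \<epsilon>\<close> by simp
  qed
  then show False using \<open>w T = m\<close> by (simp add: m_def)
qed

section \<open>Global existence and stability\<close>

text \<open>The history \<open>\<psi>\<close> covers two uses: \<open>a = t0\<close> with
  \<open>\<psi> = \<phi>\<close> gives existence, and \<open>a = tf\<close> extends a given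
  solution. The equation is assumed only strictly between \<open>t0\<close> and \<open>a\<close>; at
  these two times it is recovered from continuity.\<close>

lemma solution_continuation:
  assumes \<phi>: "\<phi> \<in> init_funs \<tau> t0 \<delta>0" and \<delta>: "\<delta> \<in> {0<..<\<delta>1}"
    and small: "\<And>s. s \<in> {t0 - r \<delta>..t0} \<Longrightarrow> norm (\<phi> s) < \<delta> * exp (- L * (real k * r \<delta>))"
    and "t0 \<le> a" and \<psi>: "continuous_on {t0 - r \<delta>0..a} \<psi>" "\<And>s. s \<in> {t0 - r \<delta>0..t0} \<Longrightarrow> \<psi> s = \<phi> s"
    and \<psi>_deriv: "\<And>t. t0 < t \<Longrightarrow> t < a \<Longrightarrow> (\<psi> has_vector_derivative delay_rhs f \<tau> \<psi> t) (at t)"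
    and \<psi>_delay: "\<And>t i. t0 < t \<Longrightarrow> t < a \<Longrightarrow> t - \<tau> i t (\<psi> t) \<in> {t0 - r \<delta>0..a}"
  obtains w where "dde_solution f \<tau> t0 \<delta>0 \<phi> \<infinity> w" "\<And>t. t \<in> {t0 - r \<delta>0..a} \<Longrightarrow> w t = \<psi> t"
    "\<And>t. t0 \<le> t \<Longrightarrow> norm (w t) \<le> \<delta>"
proof -
  obtain \<delta>2 where \<delta>2: "\<delta> < \<delta>2" "\<delta>2 < \<delta>1"
    and small2: "\<And>s. s \<in> {t0 - r \<delta>2..t0} \<Longrightarrow> norm (\<phi> s) < \<delta> * exp (- L * (real k * r \<delta>2))"
    using radius_slack[OF \<phi> \<delta> small] by blast
  have \<delta>0: "0 < \<delta>" "\<delta> \<le> \<delta>0" "0 < \<delta>2" "\<delta>2 \<le> \<delta>0" using \<delta> \<delta>2 delta1 by auto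
  have r: "0 \<le> r \<delta>2" "r \<delta>2 \<le> r \<delta>0" using \<delta>0 by (auto intro: r_nonneg r_mono)
  \<comment> \<open>The solution of the truncated equation solves the original one as long as it is smaller than \<open>\<delta>2\<close>.
    There it is bounded by \<open>\<delta>\<close>, so it never reaches \<open>\<delta>2\<close>.\<close>
  define P where "P = closest_point (cball (0 :: real ^ 'd) \<delta>2)"
  have P_in: "norm (P x) \<le> \<delta>2" for x
    using closest_point_in_set[of "cball (0 :: real ^ 'd) \<delta>2" x] \<delta>0 by (simp add: P_def)
  have P_id: "P x = x" if "norm x \<le> \<delta>2" for x
    using that by (simp add: P_def closest_point_self)
  have P_cont: "continuous_on A P" for A
    unfolding P_def using \<delta>0 by (intro continuous_on_closest_point) auto
  define G where "G t u v = f t (P u) (\<chi> i. P (v $ i))" for t u and v :: "(real ^ 'd) ^ 'n"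
  \<comment> \<open>Outside the ball of radius \<open>\<delta>0\<close> a delay may be negative;
    projecting its argument gives the nonnegativity that \<open>delay_peano\<close>
    requires.\<close>
  define \<sigma> where "\<sigma> i t u = \<tau> i t (P u)" for i t u
  have "continuous_on ({a..} \<times> UNIV \<times> UNIV) (\<lambda>(t, u, v). G t u v)"
  proof -
    have "continuous_on ({a..} \<times> UNIV \<times> UNIV) (\<lambda>z. (fst z, P (fst (snd z)), \<chi> i. P (snd (snd z) $ i)))"
      by (intro continuous_intros continuous_on_compose2[OF P_cont[of UNIV]]) auto
    then have "continuous_on ({a..} \<times> UNIV \<times> UNIV)
        (\<lambda>z. (\<lambda>(t, u, v). f t u v) (fst z, P (fst (snd z)), \<chi> i. P (snd (snd z) $ i)))"
      by (rule continuous_on_compose2[OF cont_f]) (use \<open>t0 \<le> a\<close> in auto)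
    then show ?thesis by (simp add: G_def case_prod_unfold)
  qed
  moreover have "continuous_on ({a..} \<times> UNIV) (\<lambda>(t, u). \<sigma> i t u)" for i
  proof -
    have "continuous_on ({a..} \<times> UNIV) (\<lambda>z. (fst z, P (snd z)))"
      by (intro continuous_intros continuous_on_compose2[OF P_cont[of UNIV]]) auto
    then have "continuous_on ({a..} \<times> UNIV) (\<lambda>z. (\<lambda>(t, u). \<tau> i t u) (fst z, P (snd z)))"
      by (rule continuous_on_compose2[OF cont_tau]) (use \<open>t0 \<le> a\<close> in auto)
    then show ?thesis by (simp add: \<sigma>_def case_prod_unfold)
  qed
  moreover have "0 \<le> \<sigma> i t u" if "a \<le> t" for i t u
    unfolding \<sigma>_def using that \<open>t0 \<le> a\<close> order_trans[OF P_in \<delta>0(4)] by (intro tau_nonneg) auto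
  moreover have "norm (G t u v) \<le> L * \<delta>2" if "a \<le> t" for t u v
    unfolding G_def using that \<open>t0 \<le> a\<close> P_in \<delta>0 by (intro f_bound) auto
  \<comment> \<open>\<open>delay_peano\<close> takes a history on a half-line, so
    \<open>\<psi>\<close> is frozen left of its domain.\<close>
  moreover have "continuous_on {..a} (\<lambda>t. \<psi> (max t (t0 - r \<delta>0)))"
    using \<open>t0 \<le> a\<close> r by (intro continuous_on_compose2[OF \<psi>(1)] continuous_intros) auto
  ultimately have "\<exists>w. continuous_on UNIV w \<and> (\<forall>t\<le>a. w t = \<psi> (max t (t0 - r \<delta>0))) \<and>
      (\<forall>t\<ge>a. (w has_vector_derivative delay_rhs G \<sigma> w t) (at t within {a..}))"
    by (rule delay_peano[where \<sigma> = \<sigma>]) (assumption | intro exI conjI allI impI)+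
  then obtain w where w_cont: "continuous_on UNIV w" and "\<And>t. t \<le> a \<Longrightarrow> w t = \<psi> (max t (t0 - r \<delta>0))"
    and w_deriv: "\<And>t. a \<le> t \<Longrightarrow> (w has_vector_derivative delay_rhs G \<sigma> w t) (at t within {a..})"
    by blast
  then have w_past: "w t = \<psi> t" if "t \<in> {t0 - r \<delta>0..a}" for t using that by auto
  have w_init: "w s = \<phi> s" if "s \<in> {t0 - r \<delta>0..t0}" for s
    using w_past[of s] \<psi>(2)[OF that] that \<open>t0 \<le> a\<close> by auto
  have init_less: "norm (w s) < \<delta>" if "s \<in> {t0 - r \<delta>2..t0}" for s
  proof -
    have "norm (\<phi> s) < \<delta> * exp (- L * (real k * r \<delta>2))" using small2 that .
    also have "\<dots> \<le> \<delta> * 1" using L_pos \<delta>0 r by (intro mult_left_mono) auto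
    finally show ?thesis using w_init[of s] that r by auto
  qed
  \<comment> \<open>The end \<open>S\<close> is kept free: it is first a hypothetical exit time from
    the ball of radius \<open>\<delta>2\<close>, and then \<open>\<infinity>\<close>.\<close>
  have w_sol: "dde_solution f \<tau> t0 \<delta>0 \<phi> S w"
    if S: "ereal t0 < S" and less: "\<And>t. t0 \<le> t \<Longrightarrow> ereal t < S \<Longrightarrow> norm (w t) < \<delta>2" for S
  proof -
    define D where "D = {t. t0 \<le> t \<and> ereal t < S}"
    have before: "ereal s < S" if "s \<le> t" "ereal t < S" for s t
      using that by (meson ereal_less_eq(3) order_le_less_trans)
    have delay: "0 \<le> \<tau> i t (w t)" "\<tau> i t (w t) \<le> r \<delta>2" if "t \<in> D" for i t
      using that less[of t] \<delta>0 by (auto simp: D_def intro!: tau_nonneg tau_le_r)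
    have rhs_cont: "continuous_on D (delay_rhs f \<tau> w)"
      using cont_f cont_tau w_cont by (rule continuous_on_delay_rhs) (auto simp: D_def)
    have deriv_at: "(w has_vector_derivative delay_rhs f \<tau> w t) (at t)" if t: "t0 < t" "ereal t < S" "t \<noteq> a" for t
    proof (cases "t < a")
      case True
      have "delay_rhs f \<tau> \<psi> t = delay_rhs f \<tau> w t"
      proof (rule delay_rhs_cong)
        show "\<psi> t = w t" using w_past[of t] t True r by auto
        then show "\<psi> (t - \<tau> i t (w t)) = w (t - \<tau> i t (w t))" for i
          using w_past \<psi>_delay[OF t(1) True, of i] by simp
      qed
      then have "(\<psi> has_vector_derivative delay_rhs f \<tau> w t) (at t)" using \<psi>_deriv[OF t(1) True] by simp
      then show ?thesis
        by (rule has_vector_derivative_transform_within_open[where S = "{t0<..<a}"]) (use t True w_past r in auto)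
    next
      case False
      then have "a < t" using t by simp
      have "t \<in> D" using t by (simp add: D_def)
      have small_w: "norm (w s) \<le> \<delta>2" if "s \<in> {t - r \<delta>2..t}" for s
      proof (cases "s < t0")
        case True
        then show ?thesis using init_less[of s] that t \<delta>2 by auto
      next
        case False
        then show ?thesis using less[of s] that before[of s t] t by auto
      qed
      have "P (w t) = w t" using small_w[of t] r by (auto intro: P_id)
      moreover have "P (w (t - \<tau> i t (w t))) = w (t - \<tau> i t (w t))" for i
        using delay[OF \<open>t \<in> D\<close>, of i] by (intro P_id small_w) auto
      ultimately have "delay_rhs G \<sigma> w t = delay_rhs f \<tau> w t"
        by (simp add: delay_rhs_def G_def \<sigma>_def)
      moreover have "at t within {a..} = at t" using \<open>a < t\<close> by (intro at_within_interior) auto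
      ultimately show ?thesis using w_deriv[of t] \<open>a < t\<close> by simp
    qed
    have deriv: "(w has_vector_derivative delay_rhs f \<tau> w t) (at t within D)" if "t \<in> D" for t
    proof -
      have "ereal t < S" using that by (simp add: D_def)
      then obtain T where T: "t < T" "ereal T < S" using ereal_dense2[of "ereal t" S] by auto
      have "{t0..T} \<subseteq> D" using before T by (auto simp: D_def)
      then have "(w has_vector_derivative delay_rhs f \<tau> w t) (at t within {t0..T})"
      proof (intro has_vector_derivative_removable[where c = a])
        show "continuous_on {t0..T} w" using w_cont by (rule continuous_on_subset) simp
        show "continuous_on {t0..T} (delay_rhs f \<tau> w)" using rhs_cont \<open>{t0..T} \<subseteq> D\<close> by (rule continuous_on_subset)
        show "(w has_vector_derivative delay_rhs f \<tau> w s) (at s)" if "t0 < s" "s < T" "s \<noteq> a" for s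
          using that before[of s T] T(2) by (intro deriv_at) auto
        show "t \<in> {t0..T}" using \<open>t \<in> D\<close> T(1) by (simp add: D_def)
      qed
      moreover have "at t within {t0..T} = at t within D"
        using T before[of _ T] by (intro at_within_nhd[of t "{..<T}"]) (auto simp: D_def)
      ultimately show ?thesis by simp
    qed
    have "Ck_on 1 D w"
      unfolding One_nat_def
      by (rule Ck_on_Suc_vector_derivative[where u' = "delay_rhs f \<tau> w"]) (use deriv rhs_cont in auto)
    moreover have "t0 - r \<delta>0 \<le> t - \<tau> i t (w t) \<and> ereal (t - \<tau> i t (w t)) < S" if "t \<in> D" for t i
      using delay[OF that, of i] that r before[of "t - \<tau> i t (w t)" t] by (auto simp: D_def)
    ultimately show ?thesis
      using S w_init deriv unfolding dde_solution_def delay_rhs_def D_def by (auto simp del: Ck_on.simps)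
  qed
  have w_less: "norm (w t) < \<delta>2" if "t0 \<le> t" for t
  proof (rule ccontr)
    assume "\<not> norm (w t) < \<delta>2"
    define Z where "Z = {t0..t} \<inter> (\<lambda>t. norm (w t)) -` {\<delta>2..}"
    have norm_cont: "continuous_on A (\<lambda>t. norm (w t))" for A
      using w_cont by (auto intro: continuous_intros continuous_on_subset)
    have "closed Z" unfolding Z_def by (intro continuous_closed_preimage norm_cont) auto
    moreover have "t \<in> Z" "bdd_below Z" using that \<open>\<not> norm (w t) < \<delta>2\<close> by (auto simp: Z_def)
    ultimately have "Inf Z \<in> Z" by (intro closed_contains_Inf) auto
    define S where "S = Inf Z"
    have S: "t0 \<le> S" "S \<le> t" "\<delta>2 \<le> norm (w S)" using \<open>Inf Z \<in> Z\<close> by (auto simp: Z_def S_def)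
    have less: "norm (w s) < \<delta>2" if "t0 \<le> s" "s < S" for s
    proof (rule ccontr)
      assume "\<not> norm (w s) < \<delta>2"
      then have "s \<in> Z" using that S by (auto simp: Z_def)
      then show False using cInf_lower[OF _ \<open>bdd_below Z\<close>] that(2) by (fastforce simp: S_def)
    qed
    have "norm (w t0) < \<delta>" using init_less[of t0] r by simp
    then have "t0 < S" using S \<delta>2 by (cases "S = t0") auto
    then have sol: "dde_solution f \<tau> t0 \<delta>0 \<phi> (ereal S) w" by (intro w_sol less) auto
    \<comment> \<open>The a priori bound covers only times before \<open>S\<close>, so the
      contradiction is found at an earlier time where the norm takes a value strictly between
      \<open>\<delta>\<close> and \<open>\<delta>2\<close>.\<close>
    define \<rho> where "\<rho> = (\<delta> + \<delta>2) / 2"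
    have \<rho>: "\<delta> < \<rho>" "\<rho> < \<delta>2" using \<delta>2 by (auto simp: \<rho>_def)
    obtain s where s: "t0 \<le> s" "s \<le> S" "norm (w s) = \<rho>"
      using IVT'[of "\<lambda>t. norm (w t)" t0 \<rho> S] norm_cont \<open>norm (w t0) < \<delta>\<close> \<rho> S by auto
    then have "s < S" using S \<rho> by (cases "s = S") auto
    then have "norm (w s) \<le> \<delta>" using s by (intro solution_bounded[OF sol \<phi> \<delta> small]) auto
    then show False using s \<rho> by simp
  qed
  have sol: "dde_solution f \<tau> t0 \<delta>0 \<phi> \<infinity> w" by (rule w_sol) (auto intro: w_less)
  show thesis
    by (rule that[OF sol w_past]) (auto intro: solution_bounded[OF sol \<phi> \<delta> small])
qed

text \<open>A solution with finite end \<open>b\<close> stays within \<open>\<delta>\<close>, so its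
  derivative is at most \<open>L * \<delta>\<close>. It is therefore Lipschitz, has a limit at
  \<open>b\<close>, and can be continued from there.\<close>

lemma solution_bounded_by_small_init:
  assumes \<phi>: "\<phi> \<in> init_funs \<tau> t0 \<delta>0" and \<delta>: "\<delta> \<in> {0<..<\<delta>1}"
    and small: "\<And>s. s \<in> {t0 - r \<delta>..t0} \<Longrightarrow> norm (\<phi> s) < \<delta> * exp (- L * (real k * r \<delta>))"
    and "\<delta> \<le> \<epsilon>"
  shows "solution_bounded_by f \<tau> t0 \<delta>0 \<phi> \<epsilon>"
  unfolding solution_bounded_by_def
proof (intro conjI allI impI)
  have \<delta>0: "0 < \<delta>" "\<delta> \<le> \<delta>0" using \<delta> delta1 by auto
  have r: "0 \<le> r \<delta>" "r \<delta> \<le> r \<delta>0" using \<delta>0 by (auto intro: r_nonneg r_mono)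
  \<comment> \<open>Here \<open>a = t0\<close>, so the conditions on the open interval from
    \<open>t0\<close> to \<open>a\<close> are vacuous.\<close>
  obtain w where "dde_solution f \<tau> t0 \<delta>0 \<phi> \<infinity> w"
    by (rule solution_continuation[OF \<phi> \<delta> small order_refl, of \<phi>]) (use \<phi> in \<open>auto simp: init_funs_def\<close>)
  then show "\<exists>tf u. dde_solution f \<tau> t0 \<delta>0 \<phi> tf u" by blast
  fix tf u assume sol: "dde_solution f \<tau> t0 \<delta>0 \<phi> tf u"
  have bounded: "norm (u t) \<le> \<delta>" if "t0 \<le> t" "ereal t < tf" for t
    using solution_bounded[OF sol \<phi> \<delta> small that] .
  show "\<exists>w. dde_solution f \<tau> t0 \<delta>0 \<phi> \<infinity> w \<and> (\<forall>t\<ge>t0. ereal t < tf \<longrightarrow> w t = u t) \<and> (\<forall>t\<ge>t0. norm (w t) \<le> \<epsilon>)"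
  proof (cases tf)
    case PInf
    then show ?thesis using sol bounded \<open>\<delta> \<le> \<epsilon>\<close> by (intro exI[of _ u]) (auto intro: order_trans)
  next
    case MInf
    then show ?thesis using solution_gt[OF sol] by simp
  next
    case (real b)
    have "t0 < b" using solution_gt[OF sol] real by simp
    have deriv: "(u has_vector_derivative delay_rhs f \<tau> u t) (at t within {t0..<b})" if "t \<in> {t0..<b}" for t
      using solution_deriv[OF sol, of t] that real by (simp add: atLeastLessThan_def atLeast_def lessThan_def Collect_conj_eq)
    have rhs_le: "norm (delay_rhs f \<tau> u t) \<le> L * \<delta>" if t: "t \<in> {t0..<b}" for t
    proof (rule delay_rhs_bound)
      show "norm (u s) \<le> \<delta>" if "s \<in> {t - r \<delta>..t}" for s
      proof (cases "s < t0")
        case True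
        then have "norm (\<phi> s) < \<delta> * exp (- L * (real k * r \<delta>))" using small[of s] that t by auto
        also have "\<dots> \<le> \<delta> * 1" using L_pos \<delta>0 r by (intro mult_left_mono) auto
        finally show ?thesis using solution_init[OF sol, of s] True that t r by auto
      qed (use bounded that t real in auto)
    qed (use t \<delta>0 bounded real in auto)
    have "(L * \<delta>)-lipschitz_on {t0..<b} u"
    proof (rule bounded_derivative_imp_lipschitz)
      show "(u has_derivative (\<lambda>h. h *\<^sub>R delay_rhs f \<tau> u t)) (at t within {t0..<b})" if "t \<in> {t0..<b}" for t
        using deriv[OF that] by (simp add: has_vector_derivative_def)
      show "onorm (\<lambda>h. h *\<^sub>R delay_rhs f \<tau> u t) \<le> L * \<delta>" if "t \<in> {t0..<b}" for t
        using rhs_le[OF that] L_pos \<delta>0 by (intro onorm_bound) (auto simp: mult.commute mult_left_mono)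
    qed (use L_pos \<delta>0 in auto)
    then obtain g where g: "(L * \<delta>)-lipschitz_on (closure {t0..<b}) g" "\<And>t. t \<in> {t0..<b} \<Longrightarrow> g t = u t"
      using lipschitz_extend_closure by blast
    \<comment> \<open>\<open>g\<close> supplies the missing value at \<open>b\<close> but is tied to
      \<open>u\<close> only from \<open>t0\<close> on; the initial interval keeps
      \<open>u\<close>.\<close>
    define \<psi> where "\<psi> t = (if t \<le> t0 then u t else g t)" for t
    have \<psi>_u: "\<psi> t = u t" if "t < b" for t using that g(2)[of t] by (simp add: \<psi>_def)
    have "continuous_on ({t0 - r \<delta>0..t0} \<union> {t0..b}) \<psi>"
      unfolding \<psi>_def[abs_def]
    proof (rule continuous_on_If)
      show "continuous_on {t0 - r \<delta>0..t0} u" by (rule solution_continuous[OF sol \<phi> solution_gt[OF sol]])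
      show "continuous_on {t0..b} g"
        using lipschitz_on_continuous_on[OF g(1)] \<open>t0 < b\<close> by simp
    qed (use g(2) \<open>t0 < b\<close> in auto)
    then have \<psi>_cont: "continuous_on {t0 - r \<delta>0..b} \<psi>"
      by (rule continuous_on_subset) auto
    have delay: "t - \<tau> i t (u t) \<in> {t0 - r \<delta>0..<b}" if "t0 < t" "t < b" for t i
      using sol that real unfolding dde_solution_def by auto
    have "\<exists>w. dde_solution f \<tau> t0 \<delta>0 \<phi> \<infinity> w \<and> (\<forall>t\<in>{t0 - r \<delta>0..b}. w t = \<psi> t) \<and> (\<forall>t\<ge>t0. norm (w t) \<le> \<delta>)"
    proof (rule solution_continuation[OF \<phi> \<delta> small less_imp_le[OF \<open>t0 < b\<close>] \<psi>_cont])
      show "\<psi> s = \<phi> s" if "s \<in> {t0 - r \<delta>0..t0}" for s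
        using that solution_init[OF sol that] by (simp add: \<psi>_def)
      fix t assume t: "t0 < t" "t < b"
      show "t - \<tau> i t (\<psi> t) \<in> {t0 - r \<delta>0..b}" for i
        using delay[OF t, of i] \<psi>_u[OF t(2)] by auto
      have "delay_rhs f \<tau> u t = delay_rhs f \<tau> \<psi> t"
        using \<psi>_u t delay[OF t] by (intro delay_rhs_cong) auto
      moreover have "at t within {t0..<b} = at t" using t by (intro at_within_interior) auto
      ultimately have "(u has_vector_derivative delay_rhs f \<tau> \<psi> t) (at t)" using deriv[of t] t by simp
      then show "(\<psi> has_vector_derivative delay_rhs f \<tau> \<psi> t) (at t)"
        by (rule has_vector_derivative_transform_within_open[where S = "{..<b}"]) (use t \<psi>_u in auto)
    qed (assumption | intro exI conjI ballI allI impI)+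
    then obtain w where w: "dde_solution f \<tau> t0 \<delta>0 \<phi> \<infinity> w" "\<And>t. t \<in> {t0 - r \<delta>0..b} \<Longrightarrow> w t = \<psi> t"
      "\<And>t. t0 \<le> t \<Longrightarrow> norm (w t) \<le> \<delta>"
      by blast
    have "w t = u t" if "t0 \<le> t" "t < b" for t using w(2)[of t] \<psi>_u that r by simp
    moreover have "norm (w t) \<le> \<epsilon>" if "t0 \<le> t" for t using w(3)[OF that] \<open>\<delta> \<le> \<epsilon>\<close> by simp
    ultimately show ?thesis using w(1) real by (intro exI[of _ w]) auto
  qed
qed

lemma zero_lyapunov_stable: "lyapunov_stable f \<tau> t0 \<delta>0"
  unfolding lyapunov_stable_def
proof (intro allI impI)
  fix \<epsilon> :: real assume "0 < \<epsilon>"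
  \<comment> \<open>Halving keeps \<open>\<delta>\<close> strictly below \<open>\<delta>1\<close>.
    The threshold is then that of the quantitative bound, since \<open>init_norm\<close> runs over
    the longer interval of length \<open>r \<delta>0\<close>.\<close>
  define \<delta> where "\<delta> = min \<epsilon> (\<delta>1 / 2)"
  have \<delta>: "\<delta> \<in> {0<..<\<delta>1}" "\<delta> \<le> \<epsilon>" "0 < \<delta>" "\<delta> \<le> \<delta>0"
    using \<open>0 < \<epsilon>\<close> delta1 by (auto simp: \<delta>_def min_less_iff_disj min_le_iff_disj)
  define \<rho> where "\<rho> = \<delta> * exp (- L * (real k * r \<delta>))"
  have r: "r \<delta> \<le> r \<delta>0" using \<delta> by (intro r_mono) auto
  have "solution_bounded_by f \<tau> t0 \<delta>0 \<phi> \<epsilon>" if \<phi>: "\<phi> \<in> init_funs \<tau> t0 \<delta>0" "init_norm \<tau> t0 \<delta>0 \<phi> < \<rho>" for \<phi>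
  proof (rule solution_bounded_by_small_init[OF \<phi>(1) \<delta>(1)])
    fix s assume s: "s \<in> {t0 - r \<delta>..t0}"
    have "continuous_on {t0 - r \<delta>0..t0} (\<lambda>s. norm (\<phi> s))"
      using \<phi>(1) by (auto simp: init_funs_def intro: continuous_intros)
    then have "compact ((\<lambda>s. norm (\<phi> s)) ` {t0 - r \<delta>0..t0})" by (intro compact_continuous_image) auto
    then have "bdd_above ((\<lambda>s. norm (\<phi> s)) ` {t0 - r \<delta>0..t0})" by (intro bounded_imp_bdd_above compact_imp_bounded)
    then have "norm (\<phi> s) \<le> init_norm \<tau> t0 \<delta>0 \<phi>"
      unfolding init_norm_def using s r by (intro cSUP_upper) auto
    then show "norm (\<phi> s) < \<delta> * exp (- L * (real k * r \<delta>))" using \<phi>(2) by (simp add: \<rho>_def)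
  qed (rule \<delta>(2))
  moreover have "0 < \<rho>" using \<delta> by (simp add: \<rho>_def)
  ultimately show "\<exists>\<rho>>0. \<forall>\<phi>\<in>init_funs \<tau> t0 \<delta>0. init_norm \<tau> t0 \<delta>0 \<phi> < \<rho> \<longrightarrow> solution_bounded_by f \<tau> t0 \<delta>0 \<phi> \<epsilon>"
    by blast
qed

end

theorem theorem2p6:
  fixes f :: "real \<Rightarrow> real ^ 'd \<Rightarrow> (real ^ 'd) ^ 'n \<Rightarrow> real ^ 'd"
    and \<tau> :: "'n::finite \<Rightarrow> real \<Rightarrow> real ^ 'd \<Rightarrow> real"
    and t0 \<delta>0 \<delta>1 L0 L :: real
    and Lv L\<tau> :: "'n \<Rightarrow> real"
    and k :: nat
  assumes k: "k \<ge> 1"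
    and cont_f: "continuous_on ({t0..} \<times> UNIV \<times> UNIV) (\<lambda>(t, u, v). f t u v)"
    and cont_tau: "\<And>i. continuous_on ({t0..} \<times> UNIV) (\<lambda>(t, u). \<tau> i t u)"
    and zero: "\<And>t. t \<ge> t0 \<Longrightarrow> f t 0 0 = 0"
    and tau_max: "0 < tau_max \<tau> t0" "tau_max \<tau> t0 < \<infinity>"
    and pos: "\<delta>0 > 0" "L0 > 0" "\<And>i. Lv i > 0"
    and lip_f: "\<And>t u u' v v'. t \<ge> t0 \<Longrightarrow> u \<in> cball 0 \<delta>0 \<Longrightarrow> u' \<in> cball 0 \<delta>0 \<Longrightarrow>
        (\<And>i. v $ i \<in> cball 0 \<delta>0) \<Longrightarrow> (\<And>i. v' $ i \<in> cball 0 \<delta>0) \<Longrightarrow>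
        norm (f t u v - f t u' v') \<le> L0 * norm (u - u') + (\<Sum>i\<in>UNIV. Lv i * norm (v $ i - v' $ i))"
    and L: "L = L0 + (\<Sum>i\<in>UNIV. Lv i)"
    and tau_nonneg: "\<And>i t u. t \<ge> t0 \<Longrightarrow> u \<in> cball 0 \<delta>0 \<Longrightarrow> \<tau> i t u \<ge> 0"
    and lip_tau: "\<And>i t. t \<ge> t0 \<Longrightarrow> (L\<tau> i)-lipschitz_on (cball 0 \<delta>0) (\<tau> i t)"
    and smooth: "dde_smooth f \<tau> t0 k"
    and delta1: "\<delta>1 \<in> {0<..\<delta>0}"
    and razumikhin: "\<And>\<delta> x ts \<eta>. \<delta> \<in> {0<..<\<delta>1} \<Longrightarrow> norm x = \<delta> \<Longrightarrow>
        ts \<ge> t0 + real k * delay_sup \<tau> t0 \<delta> \<Longrightarrow> \<eta> \<in> E_set f \<tau> t0 \<delta>0 k \<delta> x ts \<Longrightarrow>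
        \<exists>I v. aux_solution f \<tau> x ts \<eta> I v \<and> \<tau> I ts x > 0 \<and>
          (1 / \<delta> * (v 0 \<bullet> x) < \<delta> \<or>
           1 / \<delta> * (v 0 \<bullet> x) = \<delta> \<and>
             vector_derivative v (at 0 within {- \<tau> I ts x..0}) \<bullet> x \<le> 0)"
  shows "lyapunov_stable f \<tau> t0 \<delta>0 \<and>
    (\<forall>\<delta>\<in>{0<..<\<delta>1}. \<forall>\<phi>\<in>init_funs \<tau> t0 \<delta>0.
       (\<forall>s\<in>{t0 - delay_sup \<tau> t0 \<delta>..t0}. norm (\<phi> s) < \<delta> * exp (- L * real k * delay_sup \<tau> t0 \<delta>)) \<longrightarrow>
       solution_bounded_by f \<tau> t0 \<delta>0 \<phi> \<delta>)"
proof -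
  interpret dde_razumikhin f \<tau> t0 \<delta>0 L0 L Lv L\<tau> k \<delta>1
    by unfold_locales (fact assms)+
  show ?thesis
    using zero_lyapunov_stable solution_bounded_by_small_init[OF _ _ _ order_refl] by (simp add: mult.assoc)
qed

end
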